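(* Let $f(z)=z+\sum_{n=2}^{\infty}a_nz^n\in\mathcal{C}_1$ and let $p\ge 1$. Then $$|z|+\sum_{n=2}^{\infty}|a_nz^n|+\sum_{n=2}^{\infty}|a_n|^{p}|z|^{np}\le d(f(0),\partial f(\mathbb{D}))$$ for $|z|\le r_p$, where $r_p$ is the solution in $(0,1)$ of $$(1-r)\sum_{n=2}^{\infty}\left(2-\frac1n\right)^{p}r^{pn}-\bigl(1-3r+r\log 2-\log(2-2r)+r\log(1-r)\bigr)=0.$$ The result is sharp, i.e. for each $p\ge1$ the number $r_p$ cannot be replaced by any larger number such that the inequality still holds for all $f\in\mathcal{C}_1$.
   Context: $\mathbb{D}=\{z\in\mathbb{C}:|z|<1\}$; $d$ is the Euclidean distance and $\partial f(\mathbb{D})$ is the boundary of $f(\mathbb{D})$. A convex function is a univalent analytic function on $\mathbb{D}$ whose image is a convex domain. The class $\mathcal{C}_1$ consists of the analytic functions $f(z)=z+\sum_{n=2}^\infty a_nz^n$ on $\mathbb{D}$ for which there exists a convex function $g(z)=b_1z+\cdots$ with $\operatorname{Re}(b_1)>0$ such that $\operatorname{Re}\left(\frac{zf'(z)}{g(z)}\right)>0$ for all $z\in\mathbb{D}$ (the quotient being extended analytically to $z=0$). Here $p$ is a real number. *)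

theory Defs
  imports "HOL-Complex_Analysis.Complex_Analysis"
begin

abbreviation unit_disc :: "complex set" where
  "unit_disc \<equiv> ball 0 1"

text \<open>The image is automatically open and connected (open mapping theorem), so only its
  convexity has to be required.\<close>

definition convex_function :: "(complex \<Rightarrow> complex) \<Rightarrow> bool" where
  "convex_function g \<longleftrightarrow>
     g holomorphic_on unit_disc \<and> inj_on g unit_disc \<and> convex (g ` unit_disc)"

text \<open>The function \<open>q\<close> is the analytic extension of \<open>z f'(z) / g(z)\<close> to the origin.
  The values of \<open>f\<close> and \<open>g\<close> outside the disc are irrelevant.\<close>

definition class_C1 :: "(complex \<Rightarrow> complex) set" where
  "class_C1 = {f. f holomorphic_on unit_disc \<and> f 0 = 0 \<and> deriv f 0 = 1 \<and>
     (\<exists>g. convex_function g \<and> g 0 = 0 \<and> Re (deriv g 0) > 0 \<and>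
       (\<exists>q. q holomorphic_on unit_disc \<and>
            (\<forall>z\<in>unit_disc - {0}. q z = z * deriv f z / g z) \<and>
            (\<forall>z\<in>unit_disc. Re (q z) > 0)))}"

definition taylor_coeff :: "(complex \<Rightarrow> complex) \<Rightarrow> nat \<Rightarrow> complex" where
  "taylor_coeff f n = fps_nth (fps_expansion f 0) n"

text \<open>Series over \<open>n \<ge> 2\<close> are indexed by \<open>n + 2\<close> with \<open>n \<ge> 0\<close>.
  The two families below are the terms \<open>|a\<^sub>n z\<^sup>n|\<close> and \<open>|a\<^sub>n|\<^sup>p |z|\<^bsup>n p\<^esup>\<close>;
  as \<open>0 powr x = 0\<close>, the latter has the intended value also if \<open>a\<^sub>n = 0\<close> or \<open>z = 0\<close>.\<close>

definition bohr_term :: "(complex \<Rightarrow> complex) \<Rightarrow> complex \<Rightarrow> nat \<Rightarrow> real" where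
  "bohr_term f z n = cmod (taylor_coeff f n * z ^ n)"

definition bohr_power_term :: "real \<Rightarrow> (complex \<Rightarrow> complex) \<Rightarrow> complex \<Rightarrow> nat \<Rightarrow> real" where
  "bohr_power_term p f z n = cmod (taylor_coeff f n) powr p * cmod z powr (real n * p)"

definition bohr_inequality :: "real \<Rightarrow> (complex \<Rightarrow> complex) \<Rightarrow> complex \<Rightarrow> bool" where
  "bohr_inequality p f z \<longleftrightarrow>
     cmod z + (\<Sum>n. bohr_term f z (n + 2)) + (\<Sum>n. bohr_power_term p f z (n + 2))
       \<le> infdist (f 0) (frontier (f ` unit_disc))"

definition bohr_equation :: "real \<Rightarrow> real \<Rightarrow> bool" where
  "bohr_equation p r \<longleftrightarrow>
     (1 - r) * (\<Sum>n. (2 - 1 / real (n + 2)) powr p * r powr (p * real (n + 2)))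
       - (1 - 3 * r + r * ln 2 - ln (2 - 2 * r) + r * ln (1 - r)) = 0"

text \<open>The series in the equation converges, so its \<open>suminf\<close> is meaningful.\<close>

lemma summable_bohr_equation:
  fixes p r :: real
  assumes "p \<ge> 1" "0 < r" "r < 1"
  shows "summable (\<lambda>n. (2 - 1 / real (n + 2)) powr p * r powr (p * real (n + 2)))"
proof (rule summable_comparison_test')
  have "r powr p < 1 powr p" using assms by (intro powr_less_mono2) auto
  hence "summable (\<lambda>n. (r powr p) ^ n)" by (intro summable_geometric) auto
  hence "summable (\<lambda>n. (r powr p) ^ (n + 2))" by (subst summable_iff_shift)
  thus "summable (\<lambda>n. 2 powr p * (r powr p) ^ (n + 2))" by (rule summable_mult)
next
  fix n :: nat
  have "1 / real (n + 2) \<le> 1" by simp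
  hence "0 \<le> 2 - 1 / real (n + 2)" by linarith
  hence "(2 - 1 / real (n + 2)) powr p \<le> 2 powr p"
    using assms by (intro powr_mono2) auto
  moreover have "r powr (p * real (n + 2)) = (r powr p) ^ (n + 2)"
    using assms by (simp add: powr_powr [symmetric] powr_realpow [symmetric] del: power_Suc)
  ultimately show "norm ((2 - 1 / real (n + 2)) powr p * r powr (p * real (n + 2)))
      \<le> 2 powr p * (r powr p) ^ (n + 2)"
    by (simp add: abs_mult mult_right_mono del: power_Suc)
qed

end

theory Submission imports Defs begin

text \<open>
  Write \<open>z f' = g q\<close> with \<open>g\<close> convex and \<open>Re q > 0\<close>. Averaging over roots of unity turns the
  \<open>n\<close>-th coefficient of \<open>g\<close> (or \<open>q\<close>) into the derivative at 0 of a subordinate function, so that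
  Schwarz's lemma gives \<open>\<bar>g\<^sub>n\<bar> \<le> \<bar>g\<^sub>1\<bar>\<close> and \<open>\<bar>q\<^sub>n\<bar> \<le> 2 Re (q 0)\<close>, whence \<open>\<bar>a\<^sub>n\<bar> \<le> 2 - 1/n\<close>. Convexity of
  \<open>g\<close> gives \<open>Re (z g'/g) \<ge> 1/2\<close> and the growth bound \<open>\<bar>g z\<bar> \<ge> \<bar>g'(0)\<bar> \<bar>z\<bar> / (1 + \<bar>z\<bar>)\<close>; hence
  \<open>\<bar>f'(z)\<bar> \<ge> (1 - \<bar>z\<bar>) / (1 + \<bar>z\<bar>)\<^sup>2\<close>, and lifting segments shows that \<open>f\<close> covers the disc of radius
  \<open>1 - ln 2\<close>, the integral of this bound over \<open>[0, 1]\<close>. The frontier of the image is nonempty by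
  Liouville's theorem, as \<open>f\<close> is injective: if \<open>f + t g\<close> identifies two points of a closed disc for
  some \<open>t \<ge> 0\<close>, take the largest such \<open>t\<close>; since \<open>Re (z (f + t g)' / g) > 0\<close>, both points can be
  moved inwards while \<open>t\<close> increases, a contradiction. All bounds are attained by
  \<open>2 z / (1 - z) + Ln (1 - z)\<close>, with coefficients \<open>2 - 1/n\<close> and radial limit \<open>ln 2 - 1\<close> at \<open>-1\<close>.
\<close>

section \<open>Functions with positive real part and subordination\<close>

text \<open>The Cayley transform \<open>\<phi>\<close> sends the right half-plane to the unit disc
  and \<open>q 0\<close> to 0, so both parts are Schwarz's lemma for \<open>\<phi>\<close>, once for
  its values and once for its derivative at 0.\<close>

lemma right_half_plane_schwarz:
  assumes hol: "q holomorphic_on unit_disc" and pos: "\<And>z. z \<in> unit_disc \<Longrightarrow> Re (q z) > 0"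
  shows "z \<in> unit_disc \<Longrightarrow> cmod (q z - q 0) \<le> cmod z * cmod (q z + cnj (q 0))"
    and "cmod (deriv q 0) \<le> 2 * Re (q 0)"
proof -
  define \<phi> where "\<phi> = (\<lambda>z. (q z - q 0) / (q z + cnj (q 0)))"
  have nz: "q z + cnj (q 0) \<noteq> 0" if "z \<in> unit_disc" for z
  proof -
    have "Re (q z + cnj (q 0)) > 0" using pos[OF that] pos[of 0] by simp
    thus ?thesis by (metis less_irrefl zero_complex.sel(1))
  qed
  have hol\<phi>: "\<phi> holomorphic_on unit_disc"
    unfolding \<phi>_def using nz by (intro holomorphic_intros hol) auto
  have small: "cmod (\<phi> z) < 1" if "cmod z < 1" for z
  proof -
    have z: "z \<in> unit_disc" using that by simp
    \<comment> \<open>The identity behind this is |a + cnj b|^2 - |a - b|^2 = 4 Re a Re b.\<close>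
    have "0 < Re (q z) * Re (q 0)" using pos[OF z] pos[of 0] by simp
    hence "(cmod (q z - q 0))\<^sup>2 < (cmod (q z + cnj (q 0)))\<^sup>2"
      by (simp add: cmod_power2) (simp add: power2_eq_square algebra_simps)
    hence "cmod (q z - q 0) < cmod (q z + cnj (q 0))"
      by (rule power2_less_imp_less) simp
    thus ?thesis using nz[OF z] by (simp add: \<phi>_def norm_divide)
  qed
  have "\<phi> 0 = 0" by (simp add: \<phi>_def)
  note sch = Schwarz_Lemma[OF hol\<phi> this small]
  show "cmod (q z - q 0) \<le> cmod z * cmod (q z + cnj (q 0))" if "z \<in> unit_disc"
    using sch(1)[of z] nz[OF that] that by (simp add: \<phi>_def norm_divide field_simps)
  have dq: "(q has_field_derivative deriv q 0) (at 0)"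
    using hol by (intro holomorphic_derivI[of _ unit_disc]) auto
  have "(\<phi> has_field_derivative
      (deriv q 0 * (q 0 + cnj (q 0)) - (q 0 - q 0) * deriv q 0) / ((q 0 + cnj (q 0)) * (q 0 + cnj (q 0)))) (at 0)"
    unfolding \<phi>_def using nz[of 0] by (auto intro!: derivative_eq_intros dq)
  hence "deriv \<phi> 0 = deriv q 0 / (q 0 + cnj (q 0))"
    using nz[of 0] by (subst DERIV_imp_deriv) (assumption, simp)
  also have "q 0 + cnj (q 0) = of_real (2 * Re (q 0))"
    by (simp add: complex_add_cnj)
  finally show "cmod (deriv q 0) \<le> 2 * Re (q 0)"
    using sch(2)[of 0] pos[of 0] by (simp add: norm_divide norm_mult field_simps)
qed

text \<open>Adding a positive constant \<open>e\<close> to \<open>q\<close> reduces this to the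
  strict case, and then \<open>e\<close> tends to 0. This form serves the functions in
  \<open>convex_starlike_half\<close> and \<open>convex_growth\<close>, whose real parts are only
  known to be nonnegative.\<close>

lemma right_half_plane_schwarz_closed:
  assumes hol: "q holomorphic_on unit_disc" and nonneg: "\<And>z. z \<in> unit_disc \<Longrightarrow> Re (q z) \<ge> 0"
    and z: "z \<in> unit_disc"
  shows "cmod (q z - q 0) \<le> cmod z * cmod (q z + cnj (q 0))"
proof -
  have "cmod (q z - q 0) \<le> cmod z * cmod (q z + cnj (q 0) + of_real (2 * e))" if "e > 0" for e
  proof -
    have "cmod ((q z + of_real e) - (q 0 + of_real e))
        \<le> cmod z * cmod ((q z + of_real e) + cnj (q 0 + of_real e))"
      using nonneg that z
      by (intro right_half_plane_schwarz(1)[where q = "\<lambda>z. q z + of_real e"])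
        (auto intro!: holomorphic_intros hol add_nonneg_pos)
    thus ?thesis by (simp add: algebra_simps)
  qed
  hence "eventually (\<lambda>e. cmod (q z - q 0) \<le> cmod z * cmod (q z + cnj (q 0) + of_real (2 * e)))
      (at_right 0)"
    by (auto simp: eventually_at_right_less eventually_at_filter)
  moreover have "((\<lambda>e. cmod z * cmod (q z + cnj (q 0) + of_real (2 * e)))
      \<longlongrightarrow> cmod z * cmod (q z + cnj (q 0) + of_real (2 * 0))) (at_right 0)"
    by (intro tendsto_intros)
  ultimately show ?thesis
    using tendsto_lowerbound[of _ _ "at_right (0::real)"] by fastforce
qed

text \<open>The Schwarz bound with the triangle inequality applied on both of its sides. It supplies
  the factor of \<open>q\<close> in the lower bound for |f'|.\<close>

lemma right_half_plane_lower_bound: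
  assumes "q holomorphic_on unit_disc" "\<And>z. z \<in> unit_disc \<Longrightarrow> Re (q z) > 0" "z \<in> unit_disc"
  shows "cmod (q 0) * (1 - cmod z) \<le> cmod (q z) * (1 + cmod z)"
proof -
  have "cmod (q 0) - cmod (q z) \<le> cmod (q z - q 0)"
    by (metis norm_minus_commute norm_triangle_ineq2)
  also have "\<dots> \<le> cmod z * cmod (q z + cnj (q 0))"
    by (rule right_half_plane_schwarz(1)[OF assms])
  also have "\<dots> \<le> cmod z * (cmod (q z) + cmod (q 0))"
    by (intro mult_left_mono) (auto intro: order_trans[OF norm_triangle_ineq])
  finally show ?thesis by (simp add: algebra_simps)
qed

text \<open>As \<open>h\<close> inverts \<open>g\<close>, the composition of \<open>h\<close> after
  \<open>\<psi>\<close> maps the disc into itself and fixes 0, so Schwarz's lemma applies to it. The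
  derivative of \<open>h\<close> is provided for the first-order argument in
  \<open>convex_subordination\<close>.\<close>

lemma subordination:
  assumes holg: "g holomorphic_on unit_disc" and inj: "inj_on g unit_disc" and g0: "g 0 = 0"
  obtains h where "h holomorphic_on g ` unit_disc" "\<And>z. z \<in> unit_disc \<Longrightarrow> h (g z) = z"
    "\<And>z. z \<in> unit_disc \<Longrightarrow> (h has_field_derivative inverse (deriv g z)) (at (g z))"
    "\<And>\<psi>. \<psi> holomorphic_on unit_disc \<Longrightarrow> \<psi> ` unit_disc \<subseteq> g ` unit_disc \<Longrightarrow> \<psi> 0 = 0 \<Longrightarrow>
       (\<forall>z\<in>unit_disc. cmod (h (\<psi> z)) \<le> cmod z) \<and> cmod (deriv \<psi> 0) \<le> cmod (deriv g 0)"
proof -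
  obtain h where h: "h holomorphic_on g ` unit_disc"
    "\<And>z. z \<in> unit_disc \<Longrightarrow> deriv g z * deriv h (g z) = 1" "\<And>z. z \<in> unit_disc \<Longrightarrow> h (g z) = z"
    using holomorphic_has_inverse[OF holg open_ball inj] by metis
  have op: "open (g ` unit_disc)" by (rule open_mapping_thm3[OF holg open_ball inj])
  have dh: "(h has_field_derivative inverse (deriv g z)) (at (g z))" if "z \<in> unit_disc" for z
    using holomorphic_derivI[OF h(1) op, of "g z"] h(2)[OF that] that
    by (metis imageI inverse_unique)
  have "(\<forall>z\<in>unit_disc. cmod (h (\<psi> z)) \<le> cmod z) \<and> cmod (deriv \<psi> 0) \<le> cmod (deriv g 0)"
    if \<psi>: "\<psi> holomorphic_on unit_disc" "\<psi> ` unit_disc \<subseteq> g ` unit_disc" "\<psi> 0 = 0" for \<psi>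
  proof -
    have hol: "(h \<circ> \<psi>) holomorphic_on unit_disc"
      using holomorphic_on_compose_gen[OF \<psi>(1) h(1)] \<psi>(2) by blast
    have "(h \<circ> \<psi>) 0 = 0" using h(3)[of 0] g0 \<psi>(3) by simp
    moreover have "cmod ((h \<circ> \<psi>) z) < 1" if z: "cmod z < 1" for z
    proof -
      have "\<psi> z \<in> g ` unit_disc" using \<psi>(2) z by auto
      then obtain u where "u \<in> unit_disc" "\<psi> z = g u" by auto
      thus ?thesis using h(3)[of u] by simp
    qed
    ultimately have sch: "cmod z < 1 \<Longrightarrow> cmod ((h \<circ> \<psi>) z) \<le> cmod z" 
        "cmod (deriv (h \<circ> \<psi>) 0) \<le> 1" for z
      using Schwarz_Lemma[OF hol, of z] Schwarz_Lemma[OF hol, of 0] by auto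
    have d\<psi>: "(\<psi> has_field_derivative deriv \<psi> 0) (at 0)"
      using \<psi>(1) by (intro holomorphic_derivI[of _ unit_disc]) auto
    have "((h \<circ> \<psi>) has_field_derivative (inverse (deriv g 0) * deriv \<psi> 0)) (at 0)"
      using dh[of 0] g0 \<psi>(3) by (intro DERIV_chain d\<psi>) auto
    moreover have "deriv g 0 \<noteq> 0"
      using holomorphic_injective_imp_regular[OF holg open_ball inj] by simp
    ultimately have "inverse (cmod (deriv g 0)) * cmod (deriv \<psi> 0) \<le> 1"
      using sch(2) by (simp add: DERIV_imp_deriv norm_mult norm_inverse norm_divide)
    hence "cmod (deriv \<psi> 0) \<le> cmod (deriv g 0)"
      using \<open>deriv g 0 \<noteq> 0\<close> by (simp add: field_simps)
    thus ?thesis using sch(1) by simp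
  qed
  with h dh show thesis using that by blast
qed

section \<open>First-order change of the modulus along a curve\<close>

lemma norm_increasing_along:
  fixes \<gamma> :: "real \<Rightarrow> complex"
  assumes "(\<gamma> has_vector_derivative v) (at 0)" "Re (cnj (\<gamma> 0) * v) > 0"
  shows "\<exists>d>0. \<forall>s>0. s < d \<longrightarrow> cmod (\<gamma> 0) < cmod (\<gamma> s)"
proof -
  have "((\<lambda>s. \<gamma> s \<bullet> \<gamma> s) has_real_derivative 2 * Re (cnj (\<gamma> 0) * v)) (at 0)"
    using assms(1)
    by (auto intro!: derivative_eq_intros simp: has_vector_derivative_def
        has_field_derivative_def inner_complex_def fun_eq_iff algebra_simps)
  from DERIV_pos_inc_right[OF this] assms(2) obtain d where
    "d > 0" "\<And>s. 0 < s \<Longrightarrow> s < d \<Longrightarrow> \<gamma> 0 \<bullet> \<gamma> 0 < \<gamma> s \<bullet> \<gamma> s" by auto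
  thus ?thesis by (auto simp: norm_eq_sqrt_inner intro!: exI[of _ d])
qed

lemma norm_decreasing_along:
  fixes \<gamma> :: "real \<Rightarrow> complex"
  assumes "(\<gamma> has_vector_derivative v) (at 0)" "Re (cnj (\<gamma> 0) * v) < 0"
  shows "\<exists>d>0. \<forall>s>0. s < d \<longrightarrow> cmod (\<gamma> s) < cmod (\<gamma> 0)"
proof -
  have "((\<lambda>s. - (\<gamma> s \<bullet> \<gamma> s)) has_real_derivative - (2 * Re (cnj (\<gamma> 0) * v))) (at 0)"
    using assms(1)
    by (auto intro!: derivative_eq_intros simp: has_vector_derivative_def
        has_field_derivative_def inner_complex_def fun_eq_iff algebra_simps)
  moreover have "0 < - (2 * Re (cnj (\<gamma> 0) * v))" using assms(2) by linarith
  ultimately have "\<exists>d>0. \<forall>s>0. s < d \<longrightarrow> - (\<gamma> 0 \<bullet> \<gamma> 0) < - (\<gamma> (0 + s) \<bullet> \<gamma> (0 + s))"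
    by (rule DERIV_pos_inc_right)
  then obtain d where
    "d > 0" "\<And>s. 0 < s \<Longrightarrow> s < d \<Longrightarrow> \<gamma> s \<bullet> \<gamma> s < \<gamma> 0 \<bullet> \<gamma> 0" by auto
  thus ?thesis by (auto simp: norm_eq_sqrt_inner intro!: exI[of _ d])
qed

section \<open>Convex functions\<close>

text \<open>By convexity \<open>g w\<close> may be moved along the segment towards
  \<open>g (x * w)\<close>. The moved function is subordinate to \<open>g\<close>, so the lifted
  path \<open>\<gamma>\<close> never leaves the closed disc of radius |z|. A negative real part
  would make its initial velocity point outwards.\<close>

lemma convex_subordination:
  assumes g: "convex_function g" "g 0 = 0" and z: "z \<in> unit_disc" "z \<noteq> 0" and x: "cmod x \<le> 1"
  shows "Re ((g z - g (x * z)) / (z * deriv g z)) \<ge> 0"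
proof (rule ccontr)
  assume neg: "\<not> ?thesis"
  have holg: "g holomorphic_on unit_disc" and inj: "inj_on g unit_disc"
    and cvx: "convex (g ` unit_disc)" using g by (auto simp: convex_function_def)
  have in_disc: "x * w \<in> unit_disc" if "w \<in> unit_disc" for w
  proof -
    have "cmod x * cmod w \<le> 1 * cmod w" using x by (intro mult_right_mono) auto
    thus ?thesis using that by (simp add: norm_mult)
  qed
  obtain h where h: "\<And>z. z \<in> unit_disc \<Longrightarrow> h (g z) = z"
    "\<And>z. z \<in> unit_disc \<Longrightarrow> (h has_field_derivative inverse (deriv g z)) (at (g z))"
    "\<And>\<psi>. \<psi> holomorphic_on unit_disc \<Longrightarrow> \<psi> ` unit_disc \<subseteq> g ` unit_disc \<Longrightarrow> \<psi> 0 = 0 \<Longrightarrow>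
       (\<forall>z\<in>unit_disc. cmod (h (\<psi> z)) \<le> cmod z) \<and> cmod (deriv \<psi> 0) \<le> cmod (deriv g 0)"
    by (rule subordination[OF holg inj g(2)]) blast
  define \<gamma> where "\<gamma> = (\<lambda>s. h (g z + of_real s * (g (x * z) - g z)))"
  define v where "v = (g (x * z) - g z) * inverse (deriv g z)"
  have le: "cmod (\<gamma> s) \<le> cmod z" if s: "0 < s" "s < 1" for s
  proof -
    define \<psi> where "\<psi> = (\<lambda>w. g w + of_real s * (g (x * w) - g w))"
    have "g holomorphic_on (\<lambda>w. x * w) ` unit_disc"
      using in_disc by (intro holomorphic_on_subset[OF holg]) auto
    hence "(g \<circ> (\<lambda>w. x * w)) holomorphic_on unit_disc"
      by (intro holomorphic_on_compose holomorphic_intros)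
    hence "\<psi> holomorphic_on unit_disc"
      unfolding \<psi>_def by (intro holomorphic_intros holg) (simp_all add: o_def)
    moreover have "\<psi> w \<in> g ` unit_disc" if w: "w \<in> unit_disc" for w
    proof -
      have "(1 - s) *\<^sub>R g w + s *\<^sub>R g (x * w) \<in> g ` unit_disc"
        using s w in_disc[OF w] by (intro convexD[OF cvx]) auto
      thus ?thesis by (simp add: \<psi>_def scaleR_conv_of_real algebra_simps)
    qed
    moreover have "\<psi> 0 = 0" by (simp add: \<psi>_def g(2))
    ultimately show ?thesis using h(3)[of \<psi>] z(1) unfolding \<gamma>_def \<psi>_def by blast
  qed
  have "((\<lambda>s. g z + of_real s * (g (x * z) - g z)) has_vector_derivative (g (x * z) - g z)) (at 0)"
    by (auto intro!: derivative_eq_intros)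
  hence "((h \<circ> (\<lambda>s. g z + of_real s * (g (x * z) - g z))) has_vector_derivative v) (at 0)"
    unfolding v_def using h(2)[OF z(1)] by (intro field_vector_diff_chain_at) auto
  hence der: "(\<gamma> has_vector_derivative v) (at 0)" by (simp add: \<gamma>_def o_def)
  have \<gamma>0: "\<gamma> 0 = z" using h(1)[OF z(1)] by (simp add: \<gamma>_def)
  have dg: "deriv g z \<noteq> 0" using holomorphic_injective_imp_regular[OF holg open_ball inj z(1)] .
  \<comment> \<open>The sign of the real part decides whether \<open>\<gamma>\<close> leaves
    \<open>z\<close> outwards or inwards; it is opposite to that of the quotient in the
    claim.\<close>
  have "cnj z * v = - (of_real ((cmod z)\<^sup>2) * ((g z - g (x * z)) / (z * deriv g z)))"
    using z(2) dg unfolding complex_norm_square v_def by (simp add: field_simps)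
  hence "Re (cnj z * v) = - ((cmod z)\<^sup>2 * Re ((g z - g (x * z)) / (z * deriv g z)))"
    by (metis Re_complex_of_real uminus_complex.sel(1) Re_complex_of_real scaleR_complex.sel(1) scaleR_conv_of_real)
  moreover have "(cmod z)\<^sup>2 > 0" using z(2) by simp
  ultimately have "Re (cnj (\<gamma> 0) * v) > 0"
    using neg \<gamma>0 by (simp add: mult_pos_neg)
  from norm_increasing_along[OF der this] obtain d where
    d: "d > 0" "\<And>s. 0 < s \<Longrightarrow> s < d \<Longrightarrow> cmod z < cmod (\<gamma> s)" unfolding \<gamma>0 by auto
  have "cmod z < cmod (\<gamma> (min d 1 / 2))" using d(1) by (intro d(2)) auto
  moreover have "cmod (\<gamma> (min d 1 / 2)) \<le> cmod z" using d(1) by (intro le) auto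
  ultimately show False by simp
qed

text \<open>The estimate at \<open>x\<close> close to 1 of the half-plane function
  \<open>A x = (g z - g (x z)) / (z g' z)\<close>, which vanishes at 1 with derivative \<open>-1\<close>, forces
  \<open>\<bar>A 0\<bar>\<^sup>2 \<le> 2 Re (A 0)\<close>.\<close>

lemma convex_starlike_half:
  assumes g: "convex_function g" "g 0 = 0" and z: "z \<in> unit_disc" "z \<noteq> 0"
  shows "Re (z * deriv g z / g z) \<ge> 1 / 2"
proof -
  have holg: "g holomorphic_on unit_disc" and inj: "inj_on g unit_disc"
    using g by (auto simp: convex_function_def)
  have dg: "deriv g z \<noteq> 0" using holomorphic_injective_imp_regular[OF holg open_ball inj z(1)] .
  have gz: "g z \<noteq> 0" using inj z g(2) unfolding inj_on_def by (metis centre_in_ball zero_less_one)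
  define A where "A = (\<lambda>x. (g z - g (x * z)) / (z * deriv g z))"
  define a where "a = A 0"
  have a: "a = g z / (z * deriv g z)" by (simp add: a_def A_def g(2))
  have in_disc: "x * z \<in> unit_disc" if "cmod x \<le> 1" for x
  proof -
    have "cmod x * cmod z \<le> 1 * cmod z" using that by (intro mult_right_mono) auto
    also have "\<dots> < 1" using z by simp
    finally show ?thesis by (simp add: norm_mult)
  qed
  have "g holomorphic_on (\<lambda>x. x * z) ` unit_disc"
    using in_disc by (intro holomorphic_on_subset[OF holg]) auto
  hence "(g \<circ> (\<lambda>x. x * z)) holomorphic_on unit_disc"
    by (intro holomorphic_on_compose holomorphic_intros)
  hence holA: "A holomorphic_on unit_disc"
    unfolding A_def using z dg by (intro holomorphic_intros) (simp_all add: o_def)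
  have ReA: "Re (A x) \<ge> 0" if "cmod x \<le> 1" for x
    unfolding A_def using that by (intro convex_subordination g z)
  \<comment> \<open>\<open>B t\<close> is the squared Schwarz estimate for \<open>A\<close> at the
    real point \<open>t\<close>, divided by \<open>1 - t\<close>. Written with A t / (1 - t), each
    of its terms has a limit as \<open>t\<close> tends to 1 from the left.\<close>
  define B where "B = (\<lambda>t::real. (cmod a)\<^sup>2 * (1 + t) + (1 + t) * (cmod (A (of_real t)))\<^sup>2
      - 2 * Re ((A (of_real t) / of_real (1 - t)) * cnj a)
      - 2 * t\<^sup>2 * Re ((A (of_real t) / of_real (1 - t)) * a))"
  have B: "B t \<le> 0" if t: "0 < t" "t < 1" for t
  proof -
    let ?A = "A (of_real t)"
    have "cmod (?A - a) \<le> t * cmod (?A + cnj a)"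
      using right_half_plane_schwarz_closed[OF holA, of "of_real t"] ReA t by (simp add: a_def)
    hence "(cmod (?A - a))\<^sup>2 \<le> (t * cmod (?A + cnj a))\<^sup>2" by (intro power_mono) auto
    hence "(1 - t\<^sup>2) * (cmod a)\<^sup>2 + (1 - t\<^sup>2) * (cmod ?A)\<^sup>2 - 2 * Re (?A * cnj a) - 2 * t\<^sup>2 * Re (?A * a) \<le> 0"
      by (simp add: power_mult_distrib cmod_power2) (simp add: power2_eq_square algebra_simps)
    moreover have "(1 - t) * B t = (1 - t\<^sup>2) * (cmod a)\<^sup>2 + (1 - t\<^sup>2) * (cmod ?A)\<^sup>2
        - 2 * Re (?A * cnj a) - 2 * t\<^sup>2 * Re (?A * a)"
    proof -
      have key: "(1 - t) * Re (?A / of_real (1 - t) * w) = Re (?A * w)" for w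
      proof -
        have "?A * w = of_real (1 - t) * (?A / of_real (1 - t) * w)" using t by (simp add: field_simps)
        thus ?thesis by (metis Re_complex_of_real scaleR_complex.sel(1) scaleR_conv_of_real)
      qed
      have "(1 - t) * B t = (1 - t) * (1 + t) * (cmod a)\<^sup>2 + (1 - t) * (1 + t) * (cmod ?A)\<^sup>2
        - 2 * ((1 - t) * Re (?A / of_real (1 - t) * cnj a))
        - 2 * t\<^sup>2 * ((1 - t) * Re (?A / of_real (1 - t) * a))"
        unfolding B_def by (simp only: algebra_simps)
      thus ?thesis unfolding key by (simp add: power2_eq_square algebra_simps)
    qed
    ultimately have "(1 - t) * B t \<le> 0" by simp
    thus ?thesis using t by (simp add: mult_le_0_iff)
  qed
  have dgz: "(g has_field_derivative deriv g z) (at z)" by (rule holomorphic_derivI[OF holg open_ball z(1)])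
  have "((\<lambda>x. g (x * z)) has_field_derivative deriv g z * z) (at 1)"
    using dgz by (intro DERIV_chain2[where f = g]) (auto intro!: derivative_eq_intros)
  hence "((\<lambda>x. (g z - g (x * z)) * inverse (z * deriv g z)) has_field_derivative
      (0 - deriv g z * z) * inverse (z * deriv g z)) (at 1)"
    by (intro DERIV_cmult_right DERIV_diff DERIV_const)
  moreover have "(0 - deriv g z * z) * inverse (z * deriv g z) = - 1" using dg z by (simp add: field_simps)
  ultimately have dA: "(A has_field_derivative - 1) (at 1)"
    by (simp only: A_def divide_inverse)
  have A1: "A 1 = 0" by (simp add: A_def)
  have lim1: "filterlim (\<lambda>t::real. complex_of_real t) (at 1) (at_left 1)"
    unfolding filterlim_at
  proof (intro conjI)
    show "((\<lambda>t::real. complex_of_real t) \<longlongrightarrow> 1) (at_left 1)"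
      using tendsto_of_real[OF tendsto_ident_at[of "1::real" "{..<1}"], where 'a = complex] by simp
  qed (auto simp: eventually_at_filter)
  have "(A \<longlongrightarrow> 0) (at 1)"
    using DERIV_isCont[OF dA] A1 by (simp add: isCont_def)
  hence limA: "((\<lambda>t::real. A (of_real t)) \<longlongrightarrow> 0) (at_left 1)"
    by (rule filterlim_compose[OF _ lim1])
  have "((\<lambda>x. (A x - A 1) / (x - 1)) \<longlongrightarrow> - 1) (at 1)"
    using dA by (simp add: has_field_derivative_iff)
  moreover have "- ((A x - A 1) / (x - 1)) = A x / (1 - x)" for x
    using minus_divide_right[of "A x" "x - 1"] A1 by simp
  ultimately have "((\<lambda>x. A x / (1 - x)) \<longlongrightarrow> 1) (at 1)"
    using tendsto_minus[of "\<lambda>x. (A x - A 1) / (x - 1)" "- 1" "at 1"] by simp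
  from filterlim_compose[OF this lim1]
  have "((\<lambda>t::real. A (of_real t) / of_real (1 - t)) \<longlongrightarrow> 1) (at_left 1)"
    by simp
  hence "(B \<longlongrightarrow> (cmod a)\<^sup>2 * (1 + 1) + (1 + 1) * (cmod 0)\<^sup>2 - 2 * Re (1 * cnj a) - 2 * 1\<^sup>2 * Re (1 * a)) (at_left 1)"
    unfolding B_def by (intro tendsto_intros limA)
  moreover have "eventually (\<lambda>t. B t \<le> 0) (at_left 1)"
    using eventually_at_left_real[of 0 "1::real"] B by (auto elim!: eventually_mono)
  ultimately have "(cmod a)\<^sup>2 * (1 + 1) + (1 + 1) * (cmod 0)\<^sup>2 - 2 * Re (1 * cnj a) - 2 * 1\<^sup>2 * Re (1 * a) \<le> 0"
    by (intro tendsto_upperbound[of B _ "at_left 1"]) auto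
  hence "(cmod a)\<^sup>2 \<le> 2 * Re a" by simp
  moreover have "a \<noteq> 0" using a gz z dg by simp
  hence "(cmod a)\<^sup>2 > 0" by simp
  \<comment> \<open>The left side is Re (1 / a), and 1 / a is the quotient in the claim.\<close>
  ultimately have "Re a / (cmod a)\<^sup>2 \<ge> 1 / 2" by (simp add: field_simps)
  moreover have "z * deriv g z / g z = inverse a" using a by simp
  ultimately show ?thesis by (simp add: cmod_power2)
qed

text \<open>Schwarz's lemma for \<open>2 * s w - 1\<close>, where \<open>s\<close> extends w g' / g
  to 0, improves Re s >= 1/2 to Re s >= 1 / (1 + |w|). This makes |k (t z)| (1 + t |z|)
  nondecreasing for t in [0, 1], where \<open>k\<close> extends g / w; the claim compares the
  endpoints.\<close>

lemma convex_growth: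
  assumes g: "convex_function g" "g 0 = 0" and z: "z \<in> unit_disc"
  shows "cmod (deriv g 0) * cmod z \<le> cmod (g z) * (1 + cmod z)"
proof (cases "z = 0")
  case False
  have holg: "g holomorphic_on unit_disc" and inj: "inj_on g unit_disc"
    using g by (auto simp: convex_function_def)
  have dg: "deriv g w \<noteq> 0" if "w \<in> unit_disc" for w
    using holomorphic_injective_imp_regular[OF holg open_ball inj that] .
  have gnz: "g w \<noteq> 0" if "w \<in> unit_disc" "w \<noteq> 0" for w
    using inj that g(2) unfolding inj_on_def by (metis centre_in_ball zero_less_one)
  define k where "k = (\<lambda>w. if w = 0 then deriv g 0 else g w / w)"
  have holk: "k holomorphic_on unit_disc"
    using pole_lemma_open[OF holg open_ball, of 0] g(2) by (simp add: k_def cong: if_cong)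
  have knz: "k w \<noteq> 0" if "w \<in> unit_disc" for w using that dg gnz by (simp add: k_def)
  define s where "s = (\<lambda>w. deriv g w / k w)"
  have hols: "s holomorphic_on unit_disc"
    unfolding s_def using knz by (intro holomorphic_intros holk holg) auto
  have s0: "s 0 = 1" using dg[of 0] by (simp add: s_def k_def)
  have s: "s w = w * deriv g w / g w" if "w \<noteq> 0" for w using that by (simp add: s_def k_def)
  have Re_s: "Re (s w) \<ge> 1 / 2" if "w \<in> unit_disc" for w
    using convex_starlike_half[OF g that] s[of w] s0 by (cases "w = 0") auto
  have Re_s': "Re (s w) * (1 + cmod w) \<ge> 1" if w: "w \<in> unit_disc" for w
  proof (rule ccontr)
    let ?r = "cmod w" and ?a = "Re (s w)"
    assume "\<not> ?thesis"
    hence a: "?a * (1 + ?r) < 1" by simp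
    have r: "?r < 1" using w by simp
    have "cmod ((2 * s w - 1) - (2 * s 0 - 1)) \<le> cmod w * cmod ((2 * s w - 1) + cnj (2 * s 0 - 1))"
      using w
    proof (intro right_half_plane_schwarz_closed[where q = "\<lambda>w. 2 * s w - 1"])
      show "Re (2 * s w - 1) \<ge> 0" if "w \<in> unit_disc" for w using Re_s[OF that] by simp
    qed (auto intro!: holomorphic_intros hols)
    hence "cmod (2 * (s w - 1)) \<le> ?r * cmod (2 * s w)" using s0 by (simp add: algebra_simps)
    hence "cmod (s w - 1) \<le> ?r * cmod (s w)" by (simp only: norm_mult) simp
    hence "(cmod (s w - 1))\<^sup>2 \<le> (?r * cmod (s w))\<^sup>2" by (intro power_mono) auto
    hence "(1 - ?r\<^sup>2) * (?a\<^sup>2 + (Im (s w))\<^sup>2) - 2 * ?a + 1 \<le> 0"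
      by (simp only: power_mult_distrib cmod_power2) (simp add: power2_eq_square algebra_simps)
    moreover have "(1 - ?r\<^sup>2) * (Im (s w))\<^sup>2 \<ge> 0"
      using r by (intro mult_nonneg_nonneg) (auto simp: abs_square_le_1 power_le_one)
    ultimately have "(1 - ?r\<^sup>2) * ?a\<^sup>2 - 2 * ?a + 1 \<le> 0" by (simp add: algebra_simps)
    \<comment> \<open>The quadratic in \<open>?a\<close> factors, and under the assumption
      \<open>a\<close> both factors are positive.\<close>
    hence "(1 - ?a * (1 + ?r)) * (1 - ?a * (1 - ?r)) \<le> 0" by (simp add: power2_eq_square algebra_simps)
    moreover have "?a * (1 - ?r) \<le> ?a * (1 + ?r)" using Re_s[OF w] by (intro mult_left_mono) auto
    hence "(1 - ?a * (1 + ?r)) * (1 - ?a * (1 - ?r)) > 0" using a by (intro mult_pos_pos) auto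
    ultimately show False by simp
  qed
  define r where "r = cmod z"
  have r: "0 < r" "r < 1" using z False by (auto simp: r_def)
  \<comment> \<open>The square of |k (t z)| (1 + t r), with the modulus written as an inner product
    so that it can be differentiated.\<close>
  define N where "N = (\<lambda>t::real. (k (of_real t * z) \<bullet> k (of_real t * z)) * (1 + t * r)\<^sup>2)"
  have "N 0 \<le> N 1"
  proof (rule DERIV_nonneg_imp_increasing_open[where f = N])
    have in_disc: "of_real t * z \<in> unit_disc" if "0 \<le> t" "t \<le> 1" for t :: real
    proof -
      have "t * r \<le> 1 * r" using that r by (intro mult_right_mono) auto
      also have "\<dots> < 1" using r by simp
      finally show ?thesis using that by (simp add: norm_mult r_def)
    qed
    show "continuous_on {0..1} N"
      unfolding N_def using in_disc
      by (intro continuous_intros continuous_on_compose2[OF holomorphic_on_imp_continuous_on[OF holk]]) auto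
    fix t :: real assume t: "0 < t" "t < 1"
    let ?w = "of_real t * z"
    have w: "?w \<in> unit_disc" using in_disc t by simp
    have dk: "(k has_field_derivative deriv k ?w) (at ?w)" by (rule holomorphic_derivI[OF holk open_ball w])
    have "((\<lambda>t::real. of_real t * z) has_vector_derivative z) (at t)"
      by (auto intro!: derivative_eq_intros)
    hence "((k \<circ> (\<lambda>t::real. of_real t * z)) has_vector_derivative z * deriv k ?w) (at t)"
      using dk by (intro field_vector_diff_chain_at)
    hence dv: "((\<lambda>t::real. k (of_real t * z)) has_vector_derivative z * deriv k ?w) (at t)"
      by (simp add: o_def)
    define Y where "Y = 2 * (k ?w \<bullet> (z * deriv k ?w)) * (1 + t * r)\<^sup>2 + (k ?w \<bullet> k ?w) * (2 * (1 + t * r) * r)"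
    have "((\<lambda>t. k (of_real t * z) \<bullet> k (of_real t * z)) has_real_derivative 2 * (k ?w \<bullet> (z * deriv k ?w))) (at t)"
      using dv by (auto intro!: derivative_eq_intros simp: has_vector_derivative_def
        has_field_derivative_def fun_eq_iff inner_commute)
    hence dN: "(N has_real_derivative Y) (at t)"
      unfolding N_def Y_def by (auto intro!: derivative_eq_intros simp: algebra_simps)
    \<comment> \<open>Since g = w k, the function s - 1 equals w k' / k. The bound on Re s thereby
      controls the sign of \<open>Y\<close>, the derivative of \<open>N\<close>.\<close>
    have gk: "g w = w * k w" for w using g(2) by (simp add: k_def)
    have "((\<lambda>w. w * k w) has_field_derivative (?w * deriv k ?w + 1 * k ?w)) (at ?w)"
      by (rule DERIV_mult'[OF DERIV_ident dk])
    hence "deriv g ?w = ?w * deriv k ?w + k ?w" by (simp add: DERIV_imp_deriv flip: gk)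
    hence "s ?w = of_real t * (z * deriv k ?w / k ?w) + 1" using knz[OF w] by (simp add: s_def field_simps)
    hence "Re (s ?w) = t * Re (z * deriv k ?w / k ?w) + 1" by (simp del: times_divide_eq_right)
    moreover have "cmod ?w = t * r" using t by (simp add: norm_mult r_def)
    ultimately have prod: "t * (Re (z * deriv k ?w / k ?w) * (1 + t * r) + r) \<ge> 0"
      using Re_s'[OF w] by (simp add: algebra_simps)
    have "t * Y \<ge> 0"
    proof -
      have "k ?w \<bullet> (z * deriv k ?w) = (cmod (k ?w))\<^sup>2 * Re (z * deriv k ?w / k ?w)"
      proof -
        have "z * deriv k ?w = (z * deriv k ?w / k ?w) * k ?w" using knz[OF w] by simp
        hence "k ?w \<bullet> (z * deriv k ?w) = k ?w \<bullet> ((z * deriv k ?w / k ?w) * k ?w)" by (rule arg_cong)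
        also have "\<dots> = (cmod (k ?w))\<^sup>2 * Re (z * deriv k ?w / k ?w)"
          unfolding cmod_power2 inner_complex_def times_complex.sel
          by (simp only: power2_eq_square algebra_simps)
        finally show ?thesis .
      qed
      hence "t * Y = 2 * (cmod (k ?w))\<^sup>2 * (1 + t * r) * (t * (Re (z * deriv k ?w / k ?w) * (1 + t * r) + r))"
        unfolding Y_def power2_norm_eq_inner[symmetric] by (simp only: power2_eq_square algebra_simps)
      moreover have "2 * (cmod (k ?w))\<^sup>2 * (1 + t * r) \<ge> 0" using t r by simp
      ultimately show ?thesis using prod by (metis mult_nonneg_nonneg)
    qed
    hence "Y \<ge> 0" using t by (simp add: zero_le_mult_iff)
    with dN show "\<exists>y. (N has_real_derivative y) (at t) \<and> 0 \<le> y" by blast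
  qed simp
  hence "(cmod (k 0))\<^sup>2 \<le> (cmod (k z) * (1 + r))\<^sup>2"
    by (simp add: N_def power_mult_distrib flip: power2_norm_eq_inner)
  hence "cmod (k 0) \<le> cmod (k z) * (1 + r)"
    by (rule power2_le_imp_le) (use r in auto)
  thus ?thesis using False by (simp add: k_def r_def norm_divide field_simps)
qed simp

section \<open>Coefficient bounds\<close>

lemma taylor_coeff_sums:
  assumes "F holomorphic_on unit_disc" "z \<in> unit_disc"
  shows "(\<lambda>n. taylor_coeff F n * z ^ n) sums F z"
  using holomorphic_power_series[OF assms] by (simp add: taylor_coeff_def fps_expansion_def)

text \<open>\<open>\<psi> (z^n)\<close> is the mean of \<open>F\<close> over the points \<open>\<omega> z\<close> with \<open>\<omega>^n = 1\<close>.\<close>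

lemma convex_root_average:
  assumes hol: "F holomorphic_on unit_disc" and sub: "F ` unit_disc \<subseteq> S" and cvx: "convex S"
    and n: "n > 0"
  obtains \<psi> where "\<psi> holomorphic_on unit_disc" "\<psi> ` unit_disc \<subseteq> S" "\<psi> 0 = F 0"
    "deriv \<psi> 0 = taylor_coeff F n"
proof -
  define \<omega> where "\<omega> = cis (2 * pi / real n)"
  have \<omega>1: "\<omega> ^ m = 1 \<longleftrightarrow> n dvd m" for m
    using complex_root_unity_eq_1[of n m] n
    by (simp add: \<omega>_def cis_conv_exp mult_ac flip: exp_of_nat_mult)
  have \<omega>n: "\<omega> ^ n = 1" using \<omega>1[of n] by simp
  have norm\<omega>: "cmod \<omega> = 1" by (simp add: \<omega>_def)
  \<comment> \<open>Summing over the \<open>n\<close>-th roots of unity removes every exponent not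
    divisible by \<open>n\<close>.\<close>
  have avg: "(\<Sum>j<n. \<omega> ^ (j * m)) = (if n dvd m then of_nat n else 0)" for m
  proof (cases "n dvd m")
    case True
    hence "\<omega> ^ m = 1" using \<omega>1 by simp
    thus ?thesis using True by (simp add: mult.commute[of _ m] power_mult)
  next
    case False
    hence "\<omega> ^ m \<noteq> 1" using \<omega>1 by simp
    moreover have "(\<omega> ^ m) ^ n = 1" by (metis \<omega>n mult.commute power_mult power_one)
    ultimately show ?thesis using False geometric_sum[of "\<omega> ^ m" n]
      by (simp add: mult.commute[of _ m] power_mult)
  qed
  \<comment> \<open>Only every \<open>n\<close>-th coefficient of \<open>F\<close> survives in the
    average, which is thus a power series in \<open>w = z ^ n\<close>; its linear coefficient is the
    \<open>n\<close>-th one of \<open>F\<close>.\<close>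
  define \<psi> where "\<psi> = (\<lambda>w. \<Sum>m. taylor_coeff F (n * m) * w ^ m)"
  have sums: "(\<lambda>m. taylor_coeff F (n * m) * (z ^ n) ^ m) sums ((\<Sum>j<n. F (\<omega> ^ j * z)) / of_nat n)"
    if z: "z \<in> unit_disc" for z
  proof -
    have "(\<lambda>m. taylor_coeff F m * (\<omega> ^ j * z) ^ m) sums F (\<omega> ^ j * z)" for j
      using z by (intro taylor_coeff_sums hol) (simp add: norm_mult norm_power norm\<omega>)
    hence "(\<lambda>m. (\<Sum>j<n. taylor_coeff F m * (\<omega> ^ j * z) ^ m) / of_nat n)
        sums ((\<Sum>j<n. F (\<omega> ^ j * z)) / of_nat n)"
      by (intro sums_divide sums_sum)
    also have "(\<lambda>m. (\<Sum>j<n. taylor_coeff F m * (\<omega> ^ j * z) ^ m) / of_nat n)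
        = (\<lambda>m. if n dvd m then taylor_coeff F m * z ^ m else 0)"
    proof
      fix m
      have "(\<Sum>j<n. taylor_coeff F m * (\<omega> ^ j * z) ^ m) = taylor_coeff F m * z ^ m * (\<Sum>j<n. \<omega> ^ (j * m))"
        by (simp add: sum_distrib_left power_mult_distrib power_mult mult_ac)
      thus "(\<Sum>j<n. taylor_coeff F m * (\<omega> ^ j * z) ^ m) / of_nat n
          = (if n dvd m then taylor_coeff F m * z ^ m else 0)"
        using n by (simp add: avg)
    qed
    also have "\<dots> sums S \<longleftrightarrow> (\<lambda>m. (if n dvd (n * m) then taylor_coeff F (n * m) * z ^ (n * m) else 0)) sums S" for S
      using n by (intro sums_mono_reindex[symmetric]) (auto simp: strict_mono_def elim!: dvdE)
    finally show ?thesis by (simp add: power_mult)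
  qed
  \<comment> \<open>As every point of the disc is an \<open>n\<close>-th power of one, the averaging
    formula describes \<open>\<psi>\<close> on the whole disc.\<close>
  have root: "\<exists>z. z \<in> unit_disc \<and> z ^ n = w" if "w \<in> unit_disc" for w :: complex
  proof -
    obtain z where z: "w = z ^ n" using exists_complex_root n by (metis less_irrefl)
    have "cmod z < 1"
    proof (rule ccontr)
      assume "\<not> cmod z < 1"
      hence "1 \<le> cmod z ^ n" by simp
      thus False using that z by (simp add: norm_power)
    qed
    thus ?thesis using z by auto
  qed
  have \<psi>_sums: "(\<lambda>m. taylor_coeff F (n * m) * (w - 0) ^ m) sums \<psi> w" if "w \<in> unit_disc" for w
    using root[OF that] sums unfolding \<psi>_def by (auto simp: sums_iff)
  have "\<psi> holomorphic_on unit_disc" using power_series_holomorphic[OF \<psi>_sums] .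
  moreover have "\<psi> ` unit_disc \<subseteq> S"
  proof clarify
    fix w :: complex assume "w \<in> unit_disc"
    then obtain z where z: "z \<in> unit_disc" "z ^ n = w" using root by blast
    have "\<psi> w = (\<Sum>j<n. F (\<omega> ^ j * z)) / of_nat n"
      using sums[OF z(1)] z(2) by (simp add: \<psi>_def sums_iff)
    also have "\<dots> = (\<Sum>j<n. (1 / real n) *\<^sub>R F (\<omega> ^ j * z))"
      by (simp add: sum_divide_distrib scaleR_conv_of_real)
    also have "\<dots> \<in> S"
    proof (rule convex_sum[OF _ cvx])
      show "F (\<omega> ^ j * z) \<in> S" for j
        using z(1) sub by (auto simp: norm_mult norm_power norm\<omega>)
    qed (use n in auto)
    finally show "\<psi> w \<in> S" .
  qed
  moreover have "\<psi> 0 = F 0" "deriv \<psi> 0 = taylor_coeff F n"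
  proof -
    show "\<psi> 0 = F 0" unfolding \<psi>_def powser_zero by (simp add: taylor_coeff_def fps_expansion_def)
    have "\<psi> has_fps_expansion Abs_fps (\<lambda>m. taylor_coeff F (n * m))"
      using \<psi>_sums eventually_nhds_in_open[of unit_disc "0::complex"]
      by (intro has_fps_expansionI) (auto elim!: eventually_mono)
    from fps_nth_fps_expansion[OF this, of 1] show "deriv \<psi> 0 = taylor_coeff F n" by simp
  qed
  ultimately show thesis using that by blast
qed

text \<open>The root average of \<open>g\<close> has values in the convex image of \<open>g\<close>,
  so it is subordinate to \<open>g\<close>; its derivative at 0 is the coefficient in
  question.\<close>

lemma convex_coeff_bound:
  assumes g: "convex_function g" "g 0 = 0" and n: "n > 0"
  shows "cmod (taylor_coeff g n) \<le> cmod (deriv g 0)"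
proof -
  have holg: "g holomorphic_on unit_disc" and inj: "inj_on g unit_disc" and cvx: "convex (g ` unit_disc)"
    using g by (auto simp: convex_function_def)
  obtain \<psi> where "\<psi> holomorphic_on unit_disc" "\<psi> ` unit_disc \<subseteq> g ` unit_disc" "\<psi> 0 = g 0"
    "deriv \<psi> 0 = taylor_coeff g n"
    using convex_root_average[OF holg order_refl cvx n] by blast
  thus ?thesis using subordination[OF holg inj g(2)] g(2) by metis
qed

text \<open>The half-plane is convex, so the root average again has positive real part, and it
  agrees with \<open>q\<close> at 0.\<close>

lemma right_half_plane_coeff_bound:
  assumes hol: "q holomorphic_on unit_disc" and pos: "\<And>z. z \<in> unit_disc \<Longrightarrow> Re (q z) > 0"
    and n: "n > 0"
  shows "cmod (taylor_coeff q n) \<le> 2 * Re (q 0)"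
proof -
  have "q ` unit_disc \<subseteq> {z. Re z > 0}" using pos by auto
  then obtain \<psi> where \<psi>: "\<psi> holomorphic_on unit_disc" "\<psi> ` unit_disc \<subseteq> {z. Re z > 0}" "\<psi> 0 = q 0"
    "deriv \<psi> 0 = taylor_coeff q n"
    using convex_root_average[OF hol _ convex_halfspace_Re_gt n] by blast
  show ?thesis using right_half_plane_schwarz(2)[OF \<psi>(1)] \<psi>(2-4) by force
qed

text \<open>The product form holds at 0 as well. Differentiating it there gives
  \<open>deriv g 0 * q 0 = 1\<close>, through which the unknown scale of \<open>g\<close> cancels in
  the coefficient and distortion bounds.\<close>

lemma class_C1E:
  assumes "f \<in> class_C1"
  obtains g q where "f holomorphic_on unit_disc" "f 0 = 0" "deriv f 0 = 1"
    "convex_function g" "g 0 = 0" "Re (deriv g 0) > 0" "q holomorphic_on unit_disc"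
    "\<And>z. z \<in> unit_disc \<Longrightarrow> Re (q z) > 0" "\<And>z. z \<in> unit_disc \<Longrightarrow> z * deriv f z = g z * q z"
    "deriv g 0 * q 0 = 1"
proof -
  obtain g q where *: "f holomorphic_on unit_disc" "f 0 = 0" "deriv f 0 = 1"
    "convex_function g" "g 0 = 0" "Re (deriv g 0) > 0" "q holomorphic_on unit_disc"
    "\<And>z. z \<in> unit_disc \<Longrightarrow> Re (q z) > 0"
    "\<And>z. z \<in> unit_disc - {0} \<Longrightarrow> q z = z * deriv f z / g z"
    using assms unfolding class_C1_def by blast
  have holg: "g holomorphic_on unit_disc" and inj: "inj_on g unit_disc"
    using *(4) by (auto simp: convex_function_def)
  have eq: "z * deriv f z = g z * q z" if "z \<in> unit_disc" for z
  proof (cases "z = 0")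
    case False
    hence "g z \<noteq> 0" using inj that *(5) unfolding inj_on_def by (metis centre_in_ball zero_less_one)
    thus ?thesis using *(9)[of z] that False by simp
  qed (simp add: *(5))
  have d: "(h has_field_derivative deriv h 0) (at 0)" if "h holomorphic_on unit_disc" for h
    using that by (rule holomorphic_derivI) auto
  have "((\<lambda>z. z * deriv f z) has_field_derivative 0 * deriv (deriv f) 0 + 1 * deriv f 0) (at 0)"
    by (intro DERIV_mult' DERIV_ident d holomorphic_deriv *(1) open_ball)
  moreover have "((\<lambda>z. g z * q z) has_field_derivative g 0 * deriv q 0 + deriv g 0 * q 0) (at 0)"
    by (intro DERIV_mult' d holg *(7))
  hence "((\<lambda>z. z * deriv f z) has_field_derivative g 0 * deriv q 0 + deriv g 0 * q 0) (at 0)"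
    by (rule DERIV_cong_ev[THEN iffD1, rotated -1])
      (use eq eventually_nhds_in_open[of unit_disc 0] in \<open>auto elim!: eventually_mono\<close>)
  ultimately have "0 * deriv (deriv f) 0 + 1 * deriv f 0 = g 0 * deriv q 0 + deriv g 0 * q 0"
    by (rule DERIV_unique)
  hence "deriv g 0 * q 0 = 1" using *(3,5) by simp
  with * eq show thesis using that by blast
qed

text \<open>Comparing coefficients in z f' = g q makes n a_n a convolution. Its term with i = 0
  vanishes, the one with i = n is at most b |q 0| = 1, and the other n - 1 are at most 2 each, which
  gives 2 n - 1.\<close>

lemma class_C1_coeff_bound:
  assumes f: "f \<in> class_C1" and n: "n > 0"
  shows "cmod (taylor_coeff f n) \<le> 2 - 1 / real n"
proof -
  obtain g q where gq: "f holomorphic_on unit_disc" "f 0 = 0" "deriv f 0 = 1"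
    "convex_function g" "g 0 = 0" "q holomorphic_on unit_disc"
    "\<And>z. z \<in> unit_disc \<Longrightarrow> Re (q z) > 0" "\<And>z. z \<in> unit_disc \<Longrightarrow> z * deriv f z = g z * q z"
    "deriv g 0 * q 0 = 1" using class_C1E[OF f] by metis
  have holg: "g holomorphic_on unit_disc" using gq(4) by (simp add: convex_function_def)
  define b where "b = cmod (deriv g 0)"
  have bq: "b * cmod (q 0) = 1" unfolding b_def by (metis gq(9) norm_mult norm_one)
  have exp: "h has_fps_expansion fps_expansion h 0" if "h holomorphic_on unit_disc" for h
    using that by (intro has_fps_expansion_fps_expansion[of unit_disc]) auto
  have "(\<lambda>z. g z * q z) has_fps_expansion fps_expansion g 0 * fps_expansion q 0"
    by (intro has_fps_expansion_mult exp holg gq)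
  moreover have "eventually (\<lambda>z. g z * q z = z * deriv f z) (nhds 0)"
    using gq(8) eventually_nhds_in_open[of unit_disc 0] by (auto elim!: eventually_mono)
  ultimately have "(\<lambda>z. z * deriv f z) has_fps_expansion fps_expansion g 0 * fps_expansion q 0"
    by (subst (asm) has_fps_expansion_cong) auto
  moreover have "(\<lambda>z. z * deriv f z) has_fps_expansion fps_X * fps_deriv (fps_expansion f 0)"
    by (intro has_fps_expansion_mult has_fps_expansion_deriv exp gq fps_expansion_intros)
  ultimately have "fps_X * fps_deriv (fps_expansion f 0) = fps_expansion g 0 * fps_expansion q 0"
    by (metis fps_expansion_unique_complex)
  hence "fps_nth (fps_X * fps_deriv (fps_expansion f 0)) n = fps_nth (fps_expansion g 0 * fps_expansion q 0) n"
    by simp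
  hence conv: "of_nat n * taylor_coeff f n = (\<Sum>i=0..n. taylor_coeff g i * taylor_coeff q (n - i))"
    using n by (simp add: taylor_coeff_def fps_mult_nth[of "fps_expansion g 0"])
  have g0: "taylor_coeff g 0 = 0" and q0: "taylor_coeff q 0 = q 0"
    using gq(5) by (simp_all add: taylor_coeff_def fps_expansion_def)
  have gc: "cmod (taylor_coeff g i) \<le> b" if "i > 0" for i
    unfolding b_def by (rule convex_coeff_bound[OF gq(4,5) that])
  have qc: "b * cmod (taylor_coeff q i) \<le> 2" if "i > 0" for i
  proof -
    have "cmod (taylor_coeff q i) \<le> 2 * Re (q 0)" by (rule right_half_plane_coeff_bound[OF gq(6,7) that])
    also have "\<dots> \<le> 2 * cmod (q 0)" by (simp add: complex_Re_le_cmod)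
    finally have "b * cmod (taylor_coeff q i) \<le> b * (2 * cmod (q 0))"
      by (intro mult_left_mono) (auto simp: b_def)
    thus ?thesis using bq by simp
  qed
  have "real n * cmod (taylor_coeff f n) = cmod (of_nat n * taylor_coeff f n)" by (simp add: norm_mult)
  also have "\<dots> \<le> (\<Sum>i=0..n. cmod (taylor_coeff g i * taylor_coeff q (n - i)))"
    unfolding conv by (rule norm_sum)
  also have "\<dots> \<le> (\<Sum>i=0..n. if i = 0 then 0 else if i = n then 1 else 2)"
  proof (rule sum_mono)
    fix i assume i: "i \<in> {0..n}"
    show "cmod (taylor_coeff g i * taylor_coeff q (n - i)) \<le> (if i = 0 then 0 else if i = n then 1 else 2)"
    proof (cases "i = 0")
      case False
      have "cmod (taylor_coeff g i * taylor_coeff q (n - i)) \<le> b * cmod (taylor_coeff q (n - i))"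
        using gc[of i] False by (simp add: norm_mult mult_right_mono)
      thus ?thesis using qc[of "n - i"] bq q0 i False by (auto intro: order_trans)
    qed (simp add: g0)
  qed
  also have "\<dots> = 2 * real n - 1"
  proof -
    obtain m where m: "n = Suc m" using n by (cases n) auto
    have "(\<Sum>i=0..n. if i = 0 then 0 else if i = n then 1 else 2::real)
        = (\<Sum>i=1..m. if i = 0 then 0 else if i = n then 1 else 2) + 1"
      unfolding m by (subst sum.atLeast_Suc_atMost) auto
    also have "(\<Sum>i=1..m. if i = 0 then 0 else if i = n then 1 else 2::real) = (\<Sum>i=1..m. 2)"
      by (intro sum.cong) (auto simp: m)
    finally show ?thesis by (simp add: m)
  qed
  finally show ?thesis using n by (simp add: field_simps)
qed

section \<open>Injectivity\<close>

text \<open>The quotient (f z - f w) / (z - w), extended to the diagonal by the derivative. The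
  integral form gives joint continuity in the pair without a case distinction.\<close>

definition divided_difference :: "(complex \<Rightarrow> complex) \<Rightarrow> complex \<Rightarrow> complex \<Rightarrow> complex" where
  "divided_difference f z w = integral (cbox 0 1) (\<lambda>s::real. deriv f (w + of_real s * (z - w)))"

lemma segment_in_ball:
  fixes z w :: complex
  assumes "z \<in> ball 0 r" "w \<in> ball 0 r" "0 \<le> s" "s \<le> 1"
  shows "w + of_real s * (z - w) \<in> ball 0 r"
proof -
  have "(1 - s) *\<^sub>R w + s *\<^sub>R z \<in> ball 0 r"
    using assms by (intro convexD[OF convex_ball]) auto
  thus ?thesis by (simp add: scaleR_conv_of_real algebra_simps)
qed

lemma divided_difference_mult:
  assumes hol: "f holomorphic_on unit_disc" and zw: "z \<in> unit_disc" "w \<in> unit_disc"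
  shows "(z - w) * divided_difference f z w = f z - f w"
proof -
  let ?u = "\<lambda>s::real. w + of_real s * (z - w)"
  have "((\<lambda>s. (z - w) * deriv f (?u s)) has_integral (f \<circ> ?u) 1 - (f \<circ> ?u) 0) {0..1}"
  proof (rule fundamental_theorem_of_calculus)
    fix s :: real assume s: "s \<in> {0..1}"
    have "(f has_field_derivative deriv f (?u s)) (at (?u s))"
      using segment_in_ball[OF zw, of s] s by (intro holomorphic_derivI[OF hol]) auto
    moreover have "(?u has_vector_derivative (z - w)) (at s)"
      by (auto intro!: derivative_eq_intros)
    ultimately have "((f \<circ> ?u) has_vector_derivative (z - w) * deriv f (?u s)) (at s)"
      by (intro field_vector_diff_chain_at)
    thus "((f \<circ> ?u) has_vector_derivative (z - w) * deriv f (?u s)) (at s within {0..1})"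
      by (rule has_vector_derivative_at_within)
  qed simp
  from integral_unique[OF this] show ?thesis by (simp add: divided_difference_def)
qed

lemma divided_difference_self: "divided_difference f z z = deriv f z"
  by (simp add: divided_difference_def)

lemma continuous_on_divided_difference:
  assumes hol: "f holomorphic_on unit_disc"
  shows "continuous_on (unit_disc \<times> unit_disc) (\<lambda>(z, w). divided_difference f z w)"
proof -
  have "continuous_on ((unit_disc \<times> unit_disc) \<times> cbox 0 1)
      (\<lambda>(p, s::real). deriv f (snd p + of_real s * (fst p - snd p)))"
    unfolding case_prod_unfold using segment_in_ball[of _ 1]
    by (intro continuous_on_compose2[OF holomorphic_on_imp_continuous_on[OF holomorphic_deriv[OF hol open_ball]]]
        continuous_intros) auto
  from integral_continuous_on_param[OF this] show ?thesis
    by (simp add: divided_difference_def case_prod_unfold)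
qed

text \<open>For \<open>c\<close> other than 0, the equation is
  \<open>\<psi> z = of_real \<delta>\<close> with \<psi> = (F c - F z) / g z, and the local inverse
  of \<open>\<psi>\<close> at \<open>c\<close> solves it. The solution starts at \<open>c\<close>
  with velocity - g c / F' c, which points inwards by \<open>pos\<close>.\<close>

lemma inward_flow:
  assumes F: "F holomorphic_on unit_disc" and g: "g holomorphic_on unit_disc"
    and g0: "g 0 = 0" "\<And>z. z \<in> unit_disc \<Longrightarrow> z \<noteq> 0 \<Longrightarrow> g z \<noteq> 0"
    and c: "c \<in> unit_disc" and pos: "c \<noteq> 0 \<Longrightarrow> Re (c * deriv F c / g c) > 0"
  obtains \<alpha> :: "real \<Rightarrow> complex" where "(\<alpha> \<longlongrightarrow> c) (at_right 0)"
    "eventually (\<lambda>\<delta>. cmod (\<alpha> \<delta>) \<le> cmod c \<and> F (\<alpha> \<delta>) + of_real \<delta> * g (\<alpha> \<delta>) = F c) (at_right 0)"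
proof (cases "c = 0")
  case True
  \<comment> \<open>The constant curve at 0 is a solution because \<open>g 0 = 0\<close>.\<close>
  show ?thesis by (rule that[of "\<lambda>_. 0"]) (auto simp: True g0)
next
  case False
  let ?S = "unit_disc - {0::complex}"
  have S: "open ?S" "c \<in> ?S" using c False by auto
  have gc: "g c \<noteq> 0" using g0(2) c False by blast
  define \<psi> where "\<psi> = (\<lambda>z. (F c - F z) / g z)"
  have hol\<psi>: "\<psi> holomorphic_on ?S"
    unfolding \<psi>_def using g0(2)
    by (intro holomorphic_intros holomorphic_on_subset[OF F] holomorphic_on_subset[OF g]) auto
  have dF: "(F has_field_derivative deriv F c) (at c)" and dg: "(g has_field_derivative deriv g c) (at c)"
    using F g c by (auto intro: holomorphic_derivI)
  have "(\<psi> has_field_derivative ((0 - deriv F c) * g c - (F c - F c) * deriv g c) / (g c * g c)) (at c)"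
    unfolding \<psi>_def using gc by (intro DERIV_divide DERIV_diff DERIV_const dF dg)
  hence d\<psi>: "deriv \<psi> c = - deriv F c / g c" using gc by (subst DERIV_imp_deriv) (assumption, simp)
  have dFnz: "deriv F c \<noteq> 0" using pos False by auto
  obtain r where r: "r > 0" "ball c r \<subseteq> ?S" "open (\<psi> ` ball c r)" "inj_on \<psi> (ball c r)"
    using has_complex_derivative_locally_invertible[OF hol\<psi> S(2,1)] d\<psi> dFnz gc by auto
  obtain \<eta> where \<eta>: "\<eta> holomorphic_on \<psi> ` ball c r"
    "\<And>z. z \<in> ball c r \<Longrightarrow> deriv \<psi> z * deriv \<eta> (\<psi> z) = 1" "\<And>z. z \<in> ball c r \<Longrightarrow> \<eta> (\<psi> z) = z"
    using holomorphic_has_inverse[OF holomorphic_on_subset[OF hol\<psi> r(2)] open_ball r(4)] by metis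
  have \<psi>c: "\<psi> c = 0" by (simp add: \<psi>_def)
  have mem: "0 \<in> \<psi> ` ball c r" using r(1) by (auto simp: image_iff intro!: bexI[of _ c] simp: \<psi>c)
  define v where "v = deriv \<eta> 0"
  have v: "v = - g c / deriv F c"
    using \<eta>(2)[of c] r(1) d\<psi> dFnz gc by (simp add: v_def \<psi>c field_simps) (metis add.inverse_inverse)
  define \<alpha> where "\<alpha> = (\<lambda>\<delta>::real. \<eta> (of_real \<delta>))"
  have \<alpha>0: "\<alpha> 0 = c" using \<eta>(3)[of c] r(1) by (simp add: \<alpha>_def \<psi>c)
  have "(\<eta> has_field_derivative v) (at (of_real 0))"
    unfolding v_def using holomorphic_derivI[OF \<eta>(1) r(3) mem] by simp
  hence "((\<eta> \<circ> of_real) has_vector_derivative 1 * v) (at 0)"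
    by (intro field_vector_diff_chain_at) (auto intro!: derivative_eq_intros)
  hence d\<alpha>: "(\<alpha> has_vector_derivative v) (at 0)" by (simp add: \<alpha>_def o_def)
  have "Re (g c / (c * deriv F c)) > 0"
  proof -
    have "g c / (c * deriv F c) = inverse (c * deriv F c / g c)" by simp
    thus ?thesis using pos[OF False]
      by (simp only: inverse_complex.sel) (intro divide_pos_pos add_pos_nonneg; simp)
  qed
  moreover have "cnj c * v = - (of_real ((cmod c)\<^sup>2) * (g c / (c * deriv F c)))"
    using False dFnz unfolding complex_norm_square v by (simp add: field_simps)
  hence "Re (cnj c * v) = - ((cmod c)\<^sup>2 * Re (g c / (c * deriv F c)))"
    by (metis uminus_complex.sel(1) scaleR_complex.sel(1) scaleR_conv_of_real)
  ultimately have "Re (cnj (\<alpha> 0) * v) < 0" using False by (simp add: \<alpha>0)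
  from norm_decreasing_along[OF d\<alpha> this] obtain d where
    d: "d > 0" "\<And>s. 0 < s \<Longrightarrow> s < d \<Longrightarrow> cmod (\<alpha> s) < cmod c" unfolding \<alpha>0 by auto
  have "(\<alpha> \<longlongrightarrow> c) (at 0)"
    using has_vector_derivative_continuous[OF d\<alpha>] \<alpha>0 by (simp add: continuous_within)
  hence "(\<alpha> \<longlongrightarrow> c) (at_right 0)" by (rule tendsto_within_subset) auto
  moreover have "eventually (\<lambda>\<delta>. cmod (\<alpha> \<delta>) \<le> cmod c \<and> F (\<alpha> \<delta>) + of_real \<delta> * g (\<alpha> \<delta>) = F c) (at_right 0)"
  proof -
    have "((\<lambda>\<delta>::real. complex_of_real \<delta>) \<longlongrightarrow> of_real 0) (at_right 0)"
      by (intro tendsto_intros)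
    hence "eventually (\<lambda>\<delta>. complex_of_real \<delta> \<in> \<psi> ` ball c r) (at_right 0)"
      using r(3) mem by (auto intro: topological_tendstoD)
    moreover have "eventually (\<lambda>\<delta>. \<delta> \<in> {0<..<d}) (at_right 0)"
      using d(1) by (rule eventually_at_right_real)
    ultimately show ?thesis
    proof eventually_elim
      case (elim \<delta>)
      from elim(1) obtain z where z: "z \<in> ball c r" "of_real \<delta> = \<psi> z" by auto
      hence \<alpha>z: "\<alpha> \<delta> = z" using \<eta>(3) by (simp add: \<alpha>_def)
      have "g z \<noteq> 0" using g0(2) z(1) r(2) by blast
      hence "F z + of_real \<delta> * g z = F c" unfolding z(2) \<psi>_def by simp
      moreover have "cmod (\<alpha> \<delta>) < cmod c" using d(2) elim(2) by simp
      ultimately show ?case by (simp add: \<alpha>z)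
    qed
  qed
  ultimately show ?thesis by (rule that)
qed

text \<open>\<open>\<phi> (z, w)\<close> is the parameter t for which f + t g identifies
  \<open>z\<close> and \<open>w\<close>, or has vanishing derivative if they coincide.
  \<open>T\<close> collects the pairs with real t >= 0. It is compact, a coincidence of
  \<open>f\<close> puts a pair with t = 0 into it, and \<open>inward_flow\<close> increases the
  maximal t.\<close>

lemma class_C1_injective:
  assumes f: "f \<in> class_C1"
  shows "inj_on f unit_disc"
proof (rule ccontr)
  assume "\<not> inj_on f unit_disc"
  then obtain z1 z2 where z12: "z1 \<in> unit_disc" "z2 \<in> unit_disc" "z1 \<noteq> z2" "f z1 = f z2"
    by (auto simp: inj_on_def)
  obtain g q where gq: "f holomorphic_on unit_disc" "deriv f 0 = 1"
    "convex_function g" "g 0 = 0" "Re (deriv g 0) > 0"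
    "\<And>z. z \<in> unit_disc \<Longrightarrow> Re (q z) > 0" "\<And>z. z \<in> unit_disc \<Longrightarrow> z * deriv f z = g z * q z"
    using class_C1E[OF f] by metis
  have holg: "g holomorphic_on unit_disc" and inj: "inj_on g unit_disc"
    using gq(3) by (auto simp: convex_function_def)
  have gnz: "g z \<noteq> 0" if "z \<in> unit_disc" "z \<noteq> 0" for z
    using inj that gq(4) unfolding inj_on_def by (metis centre_in_ball zero_less_one)
  define r where "r = max (cmod z1) (cmod z2)"
  have r: "r < 1" using z12 by (simp add: r_def)
  define K where "K = cball (0::complex) r \<times> cball (0::complex) r"
  have KD: "K \<subseteq> unit_disc \<times> unit_disc" using r by (auto simp: K_def)
  have comp: "compact K" unfolding K_def by (intro compact_Times compact_cball)
  have ddg: "divided_difference g z w \<noteq> 0" if "z \<in> unit_disc" "w \<in> unit_disc" for z w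
  proof (cases "z = w")
    case True
    thus ?thesis
      using holomorphic_injective_imp_regular[OF holg open_ball inj that(1)] by (simp add: divided_difference_self)
  next
    case False
    hence "g z - g w \<noteq> 0" using inj that by (auto simp: inj_on_def)
    thus ?thesis using divided_difference_mult[OF holg that] by auto
  qed
  define \<phi> where "\<phi> = (\<lambda>(z, w). - divided_difference f z w / divided_difference g z w)"
  have "continuous_on K \<phi>"
    unfolding \<phi>_def case_prod_unfold
    using continuous_on_divided_difference[OF gq(1)] continuous_on_divided_difference[OF holg] KD ddg
    by (intro continuous_intros) (auto simp: case_prod_unfold elim!: continuous_on_subset)
  define T where "T = {p \<in> K. \<phi> p \<in> \<real>\<^sub>\<ge>\<^sub>0}"
  have "compact T"
  proof -
    have "closed (K \<inter> \<phi> -` \<real>\<^sub>\<ge>\<^sub>0)"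
      using \<open>continuous_on K \<phi>\<close> compact_imp_closed[OF comp]
      by (intro continuous_closed_preimage closed_nonneg_Reals_complex)
    hence "compact (K \<inter> (K \<inter> \<phi> -` \<real>\<^sub>\<ge>\<^sub>0))" by (rule compact_Int_closed[OF comp])
    thus ?thesis by (simp add: T_def vimage_def Int_def conj_commute cong: conj_cong)
  qed
  have mem_K: "(z1, z2) \<in> K" by (simp add: K_def r_def)
  have "(z1 - z2) * divided_difference f z1 z2 = 0"
    using divided_difference_mult[OF gq(1) z12(1,2)] z12(4) by simp
  hence "\<phi> (z1, z2) = 0" using z12(3) by (simp add: \<phi>_def)
  hence "(z1, z2) \<in> T" using mem_K by (simp add: T_def)
  hence "T \<noteq> {}" by blast
  moreover have "continuous_on T (\<lambda>p. Re (\<phi> p))"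
    by (intro continuous_intros continuous_on_subset[OF \<open>continuous_on K \<phi>\<close>]) (auto simp: T_def)
  ultimately obtain p where p: "p \<in> T" "\<And>p'. p' \<in> T \<Longrightarrow> Re (\<phi> p') \<le> Re (\<phi> p)"
    using continuous_attains_sup[OF \<open>compact T\<close>] by blast
  obtain a b where ab: "p = (a, b)" by (cases p)
  define t where "t = Re (\<phi> p)"
  have t: "t \<ge> 0" "\<phi> (a, b) = of_real t"
    using p(1) by (auto simp: T_def t_def ab complex_nonneg_Reals_iff complex_eq_iff)
  have abD: "a \<in> unit_disc" "b \<in> unit_disc" and abK: "cmod a \<le> r" "cmod b \<le> r"
    using p(1) r by (auto simp: T_def ab K_def)
  define F where "F = (\<lambda>z. f z + of_real t * g z)"
  have holF: "F holomorphic_on unit_disc" unfolding F_def by (intro holomorphic_intros gq holg)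
  have dF: "deriv F z = deriv f z + of_real t * deriv g z" if "z \<in> unit_disc" for z
    unfolding F_def using that holomorphic_derivI[OF gq(1) open_ball that] holomorphic_derivI[OF holg open_ball that]
    by (intro DERIV_imp_deriv DERIV_add DERIV_cmult)
  have pos: "Re (c * deriv F c / g c) > 0" if c: "c \<in> unit_disc" "c \<noteq> 0" for c
  proof -
    have "c * deriv F c / g c = q c + of_real t * (c * deriv g c / g c)"
      using gq(7)[OF c(1)] gnz[OF c] by (simp add: dF[OF c(1)] field_simps)
    moreover have "Re (c * deriv g c / g c) \<ge> 1 / 2" by (rule convex_starlike_half[OF gq(3,4) c])
    hence "t * Re (c * deriv g c / g c) \<ge> 0" using t(1) by (intro mult_nonneg_nonneg) auto
    ultimately show ?thesis using gq(6)[OF c(1)]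
      by (simp del: times_divide_eq_right)
  qed
  have dFnz: "deriv F c \<noteq> 0" if c: "c \<in> unit_disc" for c
  proof (cases "c = 0")
    case True
    have "Re (deriv F 0) = 1 + t * Re (deriv g 0)" by (simp add: dF gq(2))
    also have "\<dots> > 0" using t(1) gq(5) by (simp add: add_pos_nonneg)
    finally show ?thesis using True by auto
  next
    case False
    with pos[OF c] show ?thesis by auto
  qed
  have eq0: "divided_difference f a b + of_real t * divided_difference g a b = 0"
  proof -
    have "- divided_difference f a b = of_real t * divided_difference g a b"
      using t(2) ddg[OF abD] by (simp add: \<phi>_def field_simps)
    thus ?thesis by (metis add.right_inverse)
  qed
  \<comment> \<open>On the diagonal \<open>eq0\<close> would say that the derivative of
    \<open>F\<close> vanishes at \<open>a\<close>.\<close>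
  have "a \<noteq> b"
  proof
    assume "a = b"
    thus False using eq0 dFnz[OF abD(1)] by (simp add: divided_difference_self dF[OF abD(2)])
  qed
  have FDD: "f z + of_real s * g z - (f w + of_real s * g w) =
      (z - w) * (divided_difference f z w + of_real s * divided_difference g z w)"
    if "z \<in> unit_disc" "w \<in> unit_disc" for z w s
  proof -
    have "f z + of_real s * g z - (f w + of_real s * g w) = (f z - f w) + of_real s * (g z - g w)"
      by (simp add: algebra_simps)
    thus ?thesis
      unfolding divided_difference_mult[OF gq(1) that, symmetric]
        divided_difference_mult[OF holg that, symmetric]
      by (simp add: algebra_simps)
  qed
  have Fab: "F a = F b" using FDD[OF abD, of t] eq0 by (simp add: F_def)
  obtain \<alpha> where \<alpha>: "(\<alpha> \<longlongrightarrow> a) (at_right 0)"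
    "eventually (\<lambda>\<delta>. cmod (\<alpha> \<delta>) \<le> cmod a \<and> F (\<alpha> \<delta>) + of_real \<delta> * g (\<alpha> \<delta>) = F a) (at_right 0)"
    using inward_flow[OF holF holg gq(4) gnz abD(1) pos[OF abD(1)]] by blast
  obtain \<beta> where \<beta>: "(\<beta> \<longlongrightarrow> b) (at_right 0)"
    "eventually (\<lambda>\<delta>. cmod (\<beta> \<delta>) \<le> cmod b \<and> F (\<beta> \<delta>) + of_real \<delta> * g (\<beta> \<delta>) = F b) (at_right 0)"
    using inward_flow[OF holF holg gq(4) gnz abD(2) pos[OF abD(2)]] by blast
  have "((\<lambda>\<delta>. \<alpha> \<delta> - \<beta> \<delta>) \<longlongrightarrow> a - b) (at_right 0)" by (intro tendsto_intros \<alpha> \<beta>)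
  hence "eventually (\<lambda>\<delta>. \<alpha> \<delta> - \<beta> \<delta> \<noteq> 0) (at_right 0)"
    using \<open>a \<noteq> b\<close> by (intro tendsto_imp_eventually_ne) auto
  \<comment> \<open>The moved points have moduli at most those of \<open>a\<close> and
    \<open>b\<close>, so they stay in \<open>K\<close>, and f + (t + \<delta>) g identifies them.
    The pair thus lies in \<open>T\<close> with a parameter above the maximum.\<close>
  with \<alpha>(2) \<beta>(2) eventually_at_right_less[of "0::real"] have "eventually (\<lambda>\<delta>. False) (at_right (0::real))"
  proof eventually_elim
    case (elim \<delta>)
    let ?z = "\<alpha> \<delta>" and ?w = "\<beta> \<delta>"
    have K': "(?z, ?w) \<in> K" using elim abK by (auto simp: K_def)
    hence D: "?z \<in> unit_disc" "?w \<in> unit_disc" using KD by auto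
    have "(?z - ?w) * (divided_difference f ?z ?w + of_real (t + \<delta>) * divided_difference g ?z ?w) = 0"
      unfolding FDD[OF D, symmetric] using elim Fab by (simp add: F_def algebra_simps)
    hence "divided_difference f ?z ?w + of_real (t + \<delta>) * divided_difference g ?z ?w = 0"
      using elim by simp
    hence "- divided_difference f ?z ?w = of_real (t + \<delta>) * divided_difference g ?z ?w"
      by (metis add_eq_0_iff minus_minus)
    hence \<phi>': "\<phi> (?z, ?w) = of_real (t + \<delta>)"
      using ddg[OF D] by (simp only: \<phi>_def split_conv nonzero_mult_div_cancel_right) simp
    hence "(?z, ?w) \<in> T" using K' t(1) elim by (simp add: T_def)
    from p(2)[OF this] show False using elim by (simp add: \<phi>' flip: t_def)
  qed
  thus False by simp
qed

section \<open>Covering\<close>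

text \<open>The growth bound for \<open>g\<close> times the lower bound for \<open>q\<close>; the
  constants multiply to |g'(0) q(0)| = 1.\<close>

lemma class_C1_deriv_bound:
  assumes f: "f \<in> class_C1" and z: "z \<in> unit_disc"
  shows "(1 - cmod z) / (1 + cmod z)\<^sup>2 \<le> cmod (deriv f z)"
proof (cases "z = 0")
  case True
  obtain g q where "deriv f 0 = 1" using class_C1E[OF f] by metis
  thus ?thesis using True by simp
next
  case False
  obtain g q where gq: "convex_function g" "g 0 = 0" "q holomorphic_on unit_disc"
    "\<And>z. z \<in> unit_disc \<Longrightarrow> Re (q z) > 0" "\<And>z. z \<in> unit_disc \<Longrightarrow> z * deriv f z = g z * q z"
    "deriv g 0 * q 0 = 1" using class_C1E[OF f] by metis
  define r where "r = cmod z"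
  have r: "0 < r" "r < 1" using z False by (auto simp: r_def)
  have "cmod (deriv g 0) * r * (cmod (q 0) * (1 - r)) \<le> (cmod (g z) * (1 + r)) * (cmod (q z) * (1 + r))"
    unfolding r_def using z
    by (intro mult_mono convex_growth[OF gq(1,2)] right_half_plane_lower_bound[OF gq(3,4)]) auto
  also have "\<dots> = cmod (z * deriv f z) * (1 + r)\<^sup>2"
    unfolding gq(5)[OF z] by (simp add: norm_mult power2_eq_square algebra_simps)
  also have "cmod (deriv g 0) * r * (cmod (q 0) * (1 - r)) = cmod (deriv g 0 * q 0) * r * (1 - r)"
    by (simp add: norm_mult)
  finally have "r * (1 - r) \<le> r * (cmod (deriv f z) * (1 + r)\<^sup>2)"
    by (simp add: gq(6) norm_mult r_def)
  hence "1 - r \<le> cmod (deriv f z) * (1 + r)\<^sup>2" using r(1) by simp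
  thus ?thesis using r by (simp add: r_def divide_le_eq)
qed

text \<open>The antiderivative of (1 - t) / (1 + t)^2 vanishing at 0, that is, the lower bound for
  |f'| integrated along a radius. Its value at 1 is 1 - ln 2.\<close>

definition distortion_integral :: "real \<Rightarrow> real" where
  "distortion_integral r = 2 * r / (1 + r) - ln (1 + r)"

lemma distortion_integral_deriv:
  assumes "r > -1"
  shows "(distortion_integral has_real_derivative (1 - r) / (1 + r)\<^sup>2) (at r)"
proof -
  have nz: "1 + r \<noteq> 0" using assms by simp
  have "(distortion_integral has_real_derivative
      (2 * (1 + r) - 2 * r * 1) / ((1 + r) * (1 + r)) - 1 / (1 + r)) (at r)"
    unfolding distortion_integral_def[abs_def] using assms
    by (auto intro!: derivative_eq_intros)
  also have "(2 * (1 + r) - 2 * r * 1) / ((1 + r) * (1 + r)) - 1 / (1 + r) = (1 - r) / (1 + r)\<^sup>2"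
  proof -
    have "1 / (1 + r) = (1 + r) / ((1 + r) * (1 + r))" using nz by simp
    thus ?thesis by (simp only: power2_eq_square flip: diff_divide_distrib) simp
  qed
  finally show ?thesis .
qed

text \<open>The derivative is positive on (-1, 1) but vanishes at 1, so only interior points are
  used. Negative arguments occur because the extremal function is studied on the whole real
  diameter.\<close>

lemma distortion_integral_strict_mono:
  assumes "-1 < r" "r < s" "s \<le> 1"
  shows "distortion_integral r < distortion_integral s"
proof (rule DERIV_pos_imp_increasing_open[OF assms(2)])
  fix x assume "r < x" "x < s"
  thus "\<exists>y. (distortion_integral has_real_derivative y) (at x) \<and> 0 < y"
    using assms by (intro exI[of _ "(1 - x) / (1 + x)\<^sup>2"] conjI distortion_integral_deriv) auto
next
  show "continuous_on {r..s} distortion_integral"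
    using assms(1)
    by (intro continuous_at_imp_continuous_on) (auto intro!: DERIV_isCont distortion_integral_deriv)
qed

lemma distortion_integral_mono:
  assumes "0 \<le> r" "r \<le> s" "s \<le> 1"
  shows "distortion_integral r \<le> distortion_integral s"
  using distortion_integral_strict_mono[of r s] assms by (cases "r = s") auto

text \<open>The derivative decreases on [0, 1], so the graph lies below its tangent at
  \<open>r\<close>.\<close>

lemma distortion_integral_le:
  assumes "0 \<le> r" "r \<le> s" "s \<le> 1"
  shows "distortion_integral s \<le> distortion_integral r + (1 - r) / (1 + r)\<^sup>2 * (s - r)"
proof -
  define k where "k = (\<lambda>x. (1 - r) / (1 + r)\<^sup>2 * x - distortion_integral x)"
  have "k r \<le> k s"
  proof (rule DERIV_nonneg_imp_nondecreasing[OF assms(2)])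
    fix x assume x: "r \<le> x" "x \<le> s"
    have "(1 - x) / (1 + x)\<^sup>2 \<le> (1 - r) / (1 + r)\<^sup>2"
      using x assms by (intro frac_le power_mono) auto
    moreover have "(k has_real_derivative (1 - r) / (1 + r)\<^sup>2 - (1 - x) / (1 + x)\<^sup>2) (at x)"
    proof -
      have "(k has_real_derivative (1 - r) / (1 + r)\<^sup>2 * 1 - (1 - x) / (1 + x)\<^sup>2) (at x)"
        unfolding k_def using x assms by (intro DERIV_diff DERIV_cmult DERIV_ident distortion_integral_deriv) auto
      thus ?thesis by simp
    qed
    ultimately show "\<exists>y. (k has_real_derivative y) (at x) \<and> 0 \<le> y" by force
  qed
  thus ?thesis unfolding k_def right_diff_distrib by linarith
qed

text \<open>The segment from 0 to \<open>w\<close> is lifted point by point through local inverses of \<open>f\<close>; the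
  slack \<open>\<epsilon>\<close> absorbs the error of the linear approximation.\<close>

lemma covering_ball:
  assumes hol: "f holomorphic_on unit_disc" and f0: "f 0 = 0"
    and lower: "\<And>z. z \<in> unit_disc \<Longrightarrow> (1 - cmod z) / (1 + cmod z)\<^sup>2 \<le> cmod (deriv f z)"
    and w: "cmod w < 1 - ln 2"
  shows "w \<in> f ` unit_disc"
proof (cases "w = 0")
  case True
  thus ?thesis using f0 by (auto simp: image_iff intro!: bexI[of _ 0])
next
  case False
  \<comment> \<open>With this choice \<open>C\<close> is the midpoint of |w| and 1 - ln 2.\<close>
  define \<epsilon> where "\<epsilon> = (1 - ln 2 - cmod w) / (2 * cmod w)"
  have \<epsilon>: "\<epsilon> > 0" using w False by (simp add: \<epsilon>_def)
  define C where "C = (1 + \<epsilon>) * cmod w"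
  have C: "0 < C" "C < 1 - ln 2"
  proof -
    have "\<epsilon> * cmod w = (1 - ln 2 - cmod w) / 2" using False by (simp add: \<epsilon>_def)
    also have "\<dots> < 1 - ln 2 - cmod w" using w by simp
    finally show "C < 1 - ln 2" by (simp add: C_def distrib_right)
    show "0 < C" using \<epsilon> False by (simp add: C_def)
  qed
  have M1: "distortion_integral 1 = 1 - ln 2" by (simp add: distortion_integral_def)
  have "continuous_on {0..1} distortion_integral"
    by (intro continuous_at_imp_continuous_on) (auto intro!: DERIV_isCont distortion_integral_deriv)
  then obtain R where R: "0 \<le> R" "R \<le> 1" "distortion_integral R = C"
    using IVT'[of distortion_integral 0 C 1] C M1 by (auto simp: distortion_integral_def)
  have R1: "R < 1" using R C M1 by (cases "R = 1") auto
  \<comment> \<open>The points of the segment reached by a lift within the budget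
    \<open>s * C\<close>. The budget confines the lift to the closed disc of radius
    \<open>R < 1\<close>, which makes \<open>A\<close> the projection of a compact set.\<close>
  define A where "A = {s \<in> {0..1}. \<exists>z\<in>unit_disc. f z = of_real s * w \<and> distortion_integral (cmod z) \<le> s * C}"
  have bound: "cmod z \<le> R" if "z \<in> unit_disc" "distortion_integral (cmod z) \<le> s * C" "s \<le> 1" for z s
  proof (rule ccontr)
    assume "\<not> cmod z \<le> R"
    hence "C < distortion_integral (cmod z)"
      using that(1) R by (auto simp flip: R(3) intro!: distortion_integral_strict_mono)
    moreover have "s * C \<le> 1 * C" using that(3) C by (intro mult_right_mono) auto
    ultimately show False using that(2) by simp
  qed
  have "compact A"
  proof -
    define Z where "Z = {p \<in> {0..1} \<times> cball (0::complex) R. f (snd p) = of_real (fst p) * w \<and> distortion_integral (cmod (snd p)) \<le> fst p * C}"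
    have "A = fst ` Z"
    proof (intro equalityI subsetI)
      fix s assume "s \<in> A"
      then obtain z where "s \<in> {0..1}" "z \<in> unit_disc" "f z = of_real s * w" "distortion_integral (cmod z) \<le> s * C"
        unfolding A_def by blast
      hence "(s, z) \<in> Z" using bound[of z s] by (simp add: Z_def)
      thus "s \<in> fst ` Z" by force
    next
      fix s assume "s \<in> fst ` Z"
      thus "s \<in> A" unfolding A_def Z_def using R1 by auto
    qed
    moreover have "compact Z"
    proof -
      define X where "X = {0..1::real} \<times> cball (0::complex) R"
      have X: "compact X" unfolding X_def by (intro compact_Times compact_cball compact_Icc)
      have cont: "continuous_on X (\<lambda>p. f (snd p) - of_real (fst p) * w)"
        using R1 by (intro continuous_intros continuous_on_compose2[OF holomorphic_on_imp_continuous_on[OF hol]])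
          (auto simp: X_def)
      have "continuous_on X (\<lambda>p. distortion_integral (cmod (snd p)) - fst p * C)"
        unfolding distortion_integral_def
        by (intro continuous_intros) (auto simp: add_nonneg_eq_0_iff add_pos_nonneg intro: less_imp_neq)
      hence "closed (X \<inter> (\<lambda>p. f (snd p) - of_real (fst p) * w) -` {0})"
        "closed (X \<inter> (\<lambda>p. distortion_integral (cmod (snd p)) - fst p * C) -` {..0})"
        using cont by (auto intro!: continuous_closed_preimage compact_imp_closed[OF X])
      hence "compact (X \<inter> ((X \<inter> (\<lambda>p. f (snd p) - of_real (fst p) * w) -` {0})
          \<inter> (X \<inter> (\<lambda>p. distortion_integral (cmod (snd p)) - fst p * C) -` {..0})))"
        by (rule compact_Int_closed[OF X closed_Int])
      also have "\<dots> = Z" by (auto simp: Z_def X_def)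
      finally show ?thesis .
    qed
    ultimately show ?thesis
      by (simp add: compact_continuous_image continuous_on_fst)
  qed
  moreover have "0 \<in> A" using f0 by (auto simp: A_def distortion_integral_def intro!: bexI[of _ 0])
  ultimately obtain S where S: "S \<in> A" "\<And>s. s \<in> A \<Longrightarrow> s \<le> S"
    using compact_attains_sup[of A] by blast
  have "S = 1"
  proof (rule ccontr)
    assume "S \<noteq> 1"
    with S obtain z where S01: "0 \<le> S" "S < 1" and z: "z \<in> unit_disc" "f z = of_real S * w"
      "distortion_integral (cmod z) \<le> S * C" unfolding A_def by auto
    define m where "m = (1 - cmod z) / (1 + cmod z)\<^sup>2"
    have m: "m > 0" "m \<le> cmod (deriv f z)" using z(1) lower by (auto simp: m_def intro!: divide_pos_pos zero_less_power add_pos_nonneg)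
    hence dnz: "deriv f z \<noteq> 0" by auto
    obtain r where r: "r > 0" "ball z r \<subseteq> unit_disc" "open (f ` ball z r)" "inj_on f (ball z r)"
      using has_complex_derivative_locally_invertible[OF hol z(1) open_ball dnz] by blast
    obtain h where h: "h holomorphic_on f ` ball z r"
      "\<And>u. u \<in> ball z r \<Longrightarrow> deriv f u * deriv h (f u) = 1" "\<And>u. u \<in> ball z r \<Longrightarrow> h (f u) = u"
      using holomorphic_has_inverse[OF holomorphic_on_subset[OF hol r(2)] open_ball r(4)] by metis
    have zb: "z \<in> ball z r" using r(1) by simp
    have "(h has_derivative (\<lambda>x. deriv h (f z) * x)) (at (f z))"
      using holomorphic_derivI[OF h(1) r(3), of "f z"] zb by (auto simp: has_field_derivative_def)
    then obtain d where d: "d > 0" "\<And>y. cmod (y - f z) < d \<Longrightarrow>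
        cmod (h y - h (f z) - deriv h (f z) * (y - f z)) \<le> \<epsilon> / m * cmod (y - f z)"
      using \<epsilon> m(1) unfolding has_derivative_at_alt by (meson divide_pos_pos)
    obtain d' where d': "d' > 0" "ball (f z) d' \<subseteq> f ` ball z r"
      using r(3) zb by (meson imageI open_contains_ball)
    \<comment> \<open>The step stays within the range of the linear approximation and the domain of
      \<open>h\<close>, and does not pass the end of the segment.\<close>
    define \<sigma> where "\<sigma> = min (1 - S) (min d d' / (2 * cmod w))"
    have \<sigma>: "\<sigma> > 0" "\<sigma> \<le> 1 - S" using S01 d d' False by (auto simp: \<sigma>_def)
    have "\<sigma> \<le> min d d' / (2 * cmod w)" by (simp add: \<sigma>_def)
    hence \<sigma>w: "\<sigma> * cmod w \<le> min d d' / 2" using False by (simp add: field_simps)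
    define y where "y = of_real (S + \<sigma>) * w"
    have yf: "y - f z = of_real \<sigma> * w" by (simp add: y_def z(2) algebra_simps)
    hence ny: "cmod (y - f z) = \<sigma> * cmod w" using \<sigma> by (simp add: norm_mult)
    have "y \<in> ball (f z) d'" using ny \<sigma>w d d' by (simp add: dist_norm norm_minus_commute)
    then obtain u where u: "u \<in> ball z r" "y = f u" using d' by blast
    have uD: "u \<in> unit_disc" using u r by blast
    have hy: "h y = u" "h (f z) = z" using h(3) u zb by auto
    have dh: "cmod (deriv h (f z)) \<le> 1 / m"
    proof -
      have "cmod (deriv f z) * cmod (deriv h (f z)) = 1" using h(2)[OF zb] by (metis norm_mult norm_one)
      hence "m * cmod (deriv h (f z)) \<le> 1" using m(2) by (metis mult_right_mono norm_ge_zero)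
      thus ?thesis using m(1) by (simp add: field_simps)
    qed
    \<comment> \<open>The linear term contributes at most \<sigma> |w| / m and the approximation
      error \<epsilon> times that, together \<sigma> C / m.\<close>
    have "cmod (u - z) \<le> cmod (u - z - deriv h (f z) * (y - f z)) + cmod (deriv h (f z) * (y - f z))"
      by (metis diff_add_cancel norm_triangle_ineq)
    also have "\<dots> \<le> \<epsilon> / m * cmod (y - f z) + 1 / m * cmod (y - f z)"
    proof (rule add_mono)
      show "cmod (u - z - deriv h (f z) * (y - f z)) \<le> \<epsilon> / m * cmod (y - f z)"
        using d(2)[of y] ny \<sigma>w d d' unfolding hy by simp
      show "cmod (deriv h (f z) * (y - f z)) \<le> 1 / m * cmod (y - f z)"
        unfolding norm_mult using dh by (intro mult_right_mono) auto
    qed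
    also have "\<dots> = \<sigma> * C / m" unfolding ny C_def by (simp add: algebra_simps add_divide_distrib)
    finally have uz: "m * cmod (u - z) \<le> \<sigma> * C" using m(1) by (simp add: field_simps)
    \<comment> \<open>If the modulus does not grow, monotonicity suffices; otherwise the tangent at
      |z| has slope exactly \<open>m\<close>, which cancels the one in \<open>uz\<close>.\<close>
    have "distortion_integral (cmod u) \<le> (S + \<sigma>) * C"
    proof (cases "cmod u \<le> cmod z")
      case True
      hence "distortion_integral (cmod u) \<le> distortion_integral (cmod z)"
        using z(1) by (intro distortion_integral_mono) auto
      thus ?thesis using z(3) \<sigma> C by (simp add: algebra_simps add_increasing2)
    next
      case False
      hence "distortion_integral (cmod u) \<le> distortion_integral (cmod z) + m * (cmod u - cmod z)"
        unfolding m_def using uD by (intro distortion_integral_le) auto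
      also have "\<dots> \<le> S * C + m * cmod (u - z)"
        using z(3) m(1) by (intro add_mono mult_left_mono norm_triangle_ineq2) auto
      finally show ?thesis using uz by (simp add: algebra_simps)
    qed
    hence "S + \<sigma> \<in> A" using uD u(2) \<sigma> S01 unfolding A_def y_def by auto
    from S(2)[OF this] \<sigma> show False by simp
  qed
  thus ?thesis using S(1) unfolding A_def by (auto simp: image_iff)
qed

text \<open>By convention \<open>infdist\<close> to the empty set is 0, so the covering bound
  depends on this. With an empty frontier the image would be the plane, and the inverse of
  \<open>f\<close> bounded, entire and not constant.\<close>

lemma class_C1_frontier_nonempty:
  assumes f: "f \<in> class_C1"
  shows "frontier (f ` unit_disc) \<noteq> {}"
proof
  have hol: "f holomorphic_on unit_disc" using class_C1E[OF f] by metis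
  assume "frontier (f ` unit_disc) = {}"
  hence UNIV: "f ` unit_disc = UNIV" by (metis centre_in_ball empty_iff frontier_eq_empty image_is_empty zero_less_one)
  obtain h where h: "h holomorphic_on f ` unit_disc" "\<And>z. z \<in> unit_disc \<Longrightarrow> h (f z) = z"
    using holomorphic_has_inverse[OF hol open_ball class_C1_injective[OF f]] by metis
  have hD: "h w \<in> unit_disc" for w
  proof -
    obtain z where "z \<in> unit_disc" "w = f z" using UNIV by (metis UNIV_I imageE)
    thus ?thesis using h(2) by simp
  qed
  have "bounded (range h)" by (rule bounded_subset[OF bounded_ball]) (use hD in blast)
  then obtain c where c: "\<And>w. h w = c"
    using Liouville_theorem[of h] h(1) UNIV by (auto simp: constant_on_def)
  have "h (f 0) = 0" "h (f (1 / 2)) = 1 / 2" using h(2) by auto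
  thus False using c by simp
qed

text \<open>A frontier point is outside the open image, whereas \<open>covering_ball\<close> puts
  every point of modulus below 1 - ln 2 inside.\<close>

lemma class_C1_covering:
  assumes f: "f \<in> class_C1"
  shows "1 - ln 2 \<le> infdist (f 0) (frontier (f ` unit_disc))"
proof -
  have hol: "f holomorphic_on unit_disc" and f0: "f 0 = 0" using class_C1E[OF f] by metis+
  have op: "open (f ` unit_disc)"
    by (rule open_mapping_thm3[OF hol open_ball class_C1_injective[OF f]])
  have "1 - ln 2 \<le> dist (f 0) w" if w: "w \<in> frontier (f ` unit_disc)" for w
  proof (rule ccontr)
    assume "\<not> ?thesis"
    hence "w \<in> f ` unit_disc"
      using f0 by (intro covering_ball[OF hol f0 class_C1_deriv_bound[OF f]]) auto
    thus False using w op by (auto simp: frontier_def interior_open)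
  qed
  thus ?thesis using class_C1_frontier_nonempty[OF f]
    by (simp add: infdist_def cINF_greatest)
qed

section \<open>The extremal function\<close>

text \<open>The solution of z f' = g q for g = z / (1 - z) and q = (1 + z) / (1 - z). It attains the
  coefficient bounds, and the lower bound for |f'| on the negative radius.\<close>

definition extremal_function :: "complex \<Rightarrow> complex" where
  "extremal_function z = 2 * z / (1 - z) + Ln (1 - z)"

lemma one_minus_not_nonpos: "z \<in> unit_disc \<Longrightarrow> 1 - z \<notin> \<real>\<^sub>\<le>\<^sub>0"
proof
  assume z: "z \<in> unit_disc" and "1 - z \<in> \<real>\<^sub>\<le>\<^sub>0"
  hence "Re z \<ge> 1" by (simp add: complex_nonpos_Reals_iff)
  with z complex_Re_le_cmod[of z] show False by simp
qed

lemma extremal_function_deriv: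
  assumes z: "z \<in> unit_disc"
  shows "(extremal_function has_field_derivative (1 + z) / (1 - z)\<^sup>2) (at z)"
proof -
  have nz: "1 - z \<noteq> 0" using z by auto
  have "(extremal_function has_field_derivative
      (2 * (1 - z) - 2 * z * (- 1)) / ((1 - z) * (1 - z)) + (- 1) / (1 - z)) (at z)"
    unfolding extremal_function_def[abs_def] using nz one_minus_not_nonpos[OF z]
    by (auto intro!: derivative_eq_intros simp: inverse_eq_divide)
  also have "(2 * (1 - z) - 2 * z * (- 1)) / ((1 - z) * (1 - z)) + (- 1) / (1 - z) = (1 + z) / (1 - z)\<^sup>2"
  proof -
    have "(- 1) / (1 - z) = (- 1 * (1 - z)) / ((1 - z) * (1 - z))"
      using nonzero_mult_divide_mult_cancel_right[OF nz, of "- 1" "1 - z"] by (rule sym)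
    thus ?thesis by (simp only: power2_eq_square flip: add_divide_distrib) simp
  qed
  finally show ?thesis .
qed

text \<open>The image is the half-plane Re w > -1/2, since 1 + 2 w = (1 + z) / (1 - z); the inverse
  is w / (1 + w).\<close>

lemma half_plane_convex_function: "convex_function (\<lambda>z. z / (1 - z))"
proof -
  have nz: "1 - z \<noteq> 0" if "z \<in> unit_disc" for z :: complex using that by auto
  have hol: "(\<lambda>z. z / (1 - z)) holomorphic_on unit_disc" using nz by (intro holomorphic_intros) auto
  have inv: "z / (1 - z) / (1 + z / (1 - z)) = z" if "z \<in> unit_disc" for z :: complex
  proof -
    have "1 + z / (1 - z) = 1 / (1 - z)" using nz[OF that] by (simp add: field_simps)
    thus ?thesis using nz[OF that] by simp
  qed
  have "inj_on (\<lambda>z. z / (1 - z)) unit_disc"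
    using inv by (rule inj_on_inverseI[where g = "\<lambda>w. w / (1 + w)"])
  moreover have "(\<lambda>z. z / (1 - z)) ` unit_disc = {w. Re w > - 1 / 2}"
  proof (intro equalityI subsetI)
    fix w assume "w \<in> (\<lambda>z. z / (1 - z)) ` unit_disc"
    then obtain z where z: "z \<in> unit_disc" "w = z / (1 - z)" by blast
    have "Re (1 + 2 * w) > 0"
    proof -
      have "(1 - z) / (1 - z) + 2 * z / (1 - z) = (1 + z) / (1 - z)"
        unfolding add_divide_distrib[symmetric] by (rule arg_cong[where f = "\<lambda>x. x / (1 - z)"]) simp
      hence "1 + 2 * w = (1 + z) / (1 - z)" using nz[OF z(1)] z(2) by simp
      moreover have "(cmod z)\<^sup>2 < 1" using z(1) by (simp add: abs_square_less_1)
      hence "Re ((1 + z) * cnj (1 - z)) > 0"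
        by (simp add: cmod_power2) (simp add: power2_eq_square algebra_simps)
      ultimately show ?thesis by (simp only: Re_complex_div_gt_0)
    qed
    thus "w \<in> {w. Re w > - 1 / 2}" by simp
  next
    fix w :: complex assume "w \<in> {w. Re w > - 1 / 2}"
    hence w: "Re w > - 1 / 2" by simp
    hence "(cmod w)\<^sup>2 < (cmod (1 + w))\<^sup>2"
      by (simp add: cmod_power2) (simp add: power2_eq_square algebra_simps)
    hence lt: "cmod w < cmod (1 + w)" by (rule power2_less_imp_less) simp
    hence nz': "1 + w \<noteq> 0" by auto
    have "w / (1 + w) \<in> unit_disc" using lt nz' by (simp add: norm_divide divide_less_eq)
    moreover have "1 - w / (1 + w) = 1 / (1 + w)" using nz' by (simp add: field_simps)
    hence "w = (w / (1 + w)) / (1 - w / (1 + w))" using nz' by simp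
    ultimately show "w \<in> (\<lambda>z. z / (1 - z)) ` unit_disc" by blast
  qed
  ultimately show ?thesis
    unfolding convex_function_def using hol convex_halfspace_Re_gt by metis
qed

lemma extremal_function_class_C1: "extremal_function \<in> class_C1"
proof -
  let ?g = "\<lambda>z::complex. z / (1 - z)" and ?q = "\<lambda>z::complex. (1 + z) / (1 - z)"
  have nz: "1 - z \<noteq> 0" if "z \<in> unit_disc" for z :: complex using that by auto
  have d: "deriv extremal_function z = (1 + z) / (1 - z)\<^sup>2" if "z \<in> unit_disc" for z
    using extremal_function_deriv[OF that] by (rule DERIV_imp_deriv)
  have "extremal_function holomorphic_on unit_disc"
    unfolding holomorphic_on_open[OF open_ball] using extremal_function_deriv by blast
  moreover have "extremal_function 0 = 0" by (simp add: extremal_function_def)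
  moreover have "deriv extremal_function 0 = 1" by (simp add: d)
  moreover have "(?g has_field_derivative ((1 * (1 - 0) - 0 * (0 - 1)) / ((1 - 0) * (1 - 0)))) (at 0)"
    by (intro DERIV_divide DERIV_diff DERIV_ident DERIV_const) auto
  hence "deriv ?g 0 = 1" by (simp add: DERIV_imp_deriv)
  moreover have "?q holomorphic_on unit_disc" using nz by (intro holomorphic_intros) auto
  moreover have "?q z = z * deriv extremal_function z / ?g z" if "z \<in> unit_disc - {0}" for z
  proof -
    have "z * ((1 + z) / (1 - z)\<^sup>2) = ?g z * ?q z" by (simp add: power2_eq_square)
    moreover have "?g z \<noteq> 0" using that nz[of z] by auto
    moreover have "deriv extremal_function z = (1 + z) / (1 - z)\<^sup>2" using that by (intro d) auto
    ultimately show ?thesis by (metis nonzero_mult_div_cancel_left)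
  qed
  moreover have "Re (?q z) > 0" if "z \<in> unit_disc" for z
  proof -
    have "(cmod z)\<^sup>2 < 1" using that by (simp add: abs_square_less_1)
    hence "Re ((1 + z) * cnj (1 - z)) > 0"
      by (simp add: cmod_power2) (simp add: power2_eq_square algebra_simps)
    thus ?thesis by (simp only: Re_complex_div_gt_0)
  qed
  moreover have "?g 0 = 0" "Re 1 > 0" by simp_all
  ultimately show ?thesis
    unfolding class_C1_def mem_Collect_eq using half_plane_convex_function
    by (intro conjI exI[of _ ?g] exI[of _ ?q] ballI) (simp_all only:)
qed

section \<open>Sharpness of the covering radius 1 - ln 2\<close>

lemma extremal_function_of_real:
  assumes "-1 < x" "x < 1"
  shows "extremal_function (of_real (- x)) = of_real (- distortion_integral x)"
proof -
  have "Ln (of_real (1 + x)) = of_real (ln (1 + x))" using assms by (intro Ln_of_real) auto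
  thus ?thesis by (simp add: extremal_function_def distortion_integral_def)
qed

text \<open>The point ln 2 - 1 is the limit of the values at -x as x tends to 1. Were it a value
  itself, conjugation symmetry and injectivity would force a real preimage, which strict
  monotonicity on the real diameter excludes.\<close>

lemma extremal_function_covering:
  "infdist (extremal_function 0) (frontier (extremal_function ` unit_disc)) \<le> 1 - ln 2"
proof -
  let ?f = extremal_function and ?w = "complex_of_real (- distortion_integral 1)"
  have C1: "?f \<in> class_C1" by (rule extremal_function_class_C1)
  have "?w \<notin> ?f ` unit_disc"
  proof
    assume "?w \<in> ?f ` unit_disc"
    then obtain z where z: "z \<in> unit_disc" "?f z = ?w" by auto
    have "?f (cnj z) = cnj (?f z)"
      using one_minus_not_nonpos[OF z(1)] by (simp add: extremal_function_def cnj_Ln)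
    also have "\<dots> = ?f z" unfolding z(2) by simp
    finally have "cnj z = z"
      using class_C1_injective[OF C1] z(1) by (auto simp: inj_on_def)
    hence "z \<in> \<real>" by (simp add: Reals_cnj_iff)
    then obtain x where x: "z = of_real (- x)" by (metis Reals_cases minus_minus)
    hence x1: "-1 < x" "x < 1" using z(1) by (auto simp: abs_less_iff)
    have "distortion_integral x = distortion_integral 1"
      using z(2) extremal_function_of_real[OF x1] unfolding x by (simp only: of_real_eq_iff)
    with distortion_integral_strict_mono[of x 1] x1 show False by simp
  qed
  moreover have "?w \<in> closure (?f ` unit_disc)"
  proof -
    have 1: "(1::real) \<in> closure {0..<1}" by simp
    have "continuous_on {0..1} (\<lambda>x. complex_of_real (- distortion_integral x))"
      by (intro continuous_intros continuous_at_imp_continuous_on)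
        (auto intro!: DERIV_isCont[OF distortion_integral_deriv])
    hence "continuous_on (closure {0..<1}) (\<lambda>x. complex_of_real (- distortion_integral x))" by simp
    moreover have "complex_of_real (- distortion_integral x) \<in> closure (?f ` unit_disc)"
      if x: "x \<in> {0..<1}" for x
    proof -
      have "complex_of_real (- x) \<in> unit_disc" using x by simp
      hence "?f (of_real (- x)) \<in> closure (?f ` unit_disc)" by (intro subsetD[OF closure_subset] imageI)
      moreover have "?f (of_real (- x)) = of_real (- distortion_integral x)"
        using x by (intro extremal_function_of_real) auto
      ultimately show ?thesis by (rule back_subst)
    qed
    hence "(\<lambda>x. complex_of_real (- distortion_integral x)) ` {0..<1} \<subseteq> closure (?f ` unit_disc)" by blast
    ultimately have "(\<lambda>x. complex_of_real (- distortion_integral x)) ` closure {0..<1} \<subseteq> closure (?f ` unit_disc)"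
      by (rule image_closure_subset[OF _ closed_closure])
    from subsetD[OF this imageI[OF 1]] show ?thesis .
  qed
  ultimately have "?w \<in> frontier (?f ` unit_disc)"
    using interior_subset by (auto simp: frontier_def)
  hence "infdist (?f 0) (frontier (?f ` unit_disc)) \<le> dist (?f 0) ?w" by (rule infdist_le)
  also have "\<dots> = \<bar>distortion_integral 1\<bar>"
    by (simp add: extremal_function_def dist_norm del: of_real_minus)
  also have "\<dots> = 1 - ln 2" using ln_2_less_1 by (simp add: distortion_integral_def)
  finally show ?thesis .
qed

lemma extremal_function_coeff:
  assumes "n > 0"
  shows "taylor_coeff extremal_function n = of_real (2 - 1 / real n)"
proof -
  have "(\<lambda>n. (if n = 0 then 0 else of_real (2 - 1 / real n)) * z ^ n) sums extremal_function z"
    if z: "z \<in> unit_disc" for z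
  proof -
    have "(\<lambda>n. (-1) ^ Suc n / of_nat n * (- z) ^ n) sums Ln (1 + - z)"
      using z by (intro Ln_series) simp
    moreover have "(\<lambda>n. 2 * z * z ^ n) sums (2 * z * (1 / (1 - z)))"
      using z by (intro sums_mult geometric_sums) simp
    \<comment> \<open>The test \<open>Suc n = 0\<close> never holds; it gives the summand the shape
      that \<open>sums_Suc\<close> extends by a zeroth term 0.\<close>
    hence "(\<lambda>n. if Suc n = 0 then 0 else 2 * z ^ Suc n) sums (2 * z * (1 / (1 - z)))"
      by (simp add: mult.assoc)
    from sums_Suc[OF this] have "(\<lambda>n. if n = 0 then 0 else 2 * z ^ n) sums (2 * z * (1 / (1 - z)))"
      by simp
    ultimately have "(\<lambda>n. (if n = 0 then 0 else 2 * z ^ n) + (-1) ^ Suc n / of_nat n * (- z) ^ n) sums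
        (2 * z * (1 / (1 - z)) + Ln (1 + - z))" by (intro sums_add)
    also have "(\<lambda>n. (if n = 0 then 0 else 2 * z ^ n) + (-1) ^ Suc n / of_nat n * (- z) ^ n)
       = (\<lambda>n. (if n = 0 then 0 else of_real (2 - 1 / real n)) * z ^ n)"
    proof
      fix n
      have "(-1) ^ n * (- z) ^ n = z ^ n" by (simp flip: power_mult_distrib)
      thus "(if n = 0 then 0 else 2 * z ^ n) + (-1) ^ Suc n / of_nat n * (- z) ^ n
         = (if n = 0 then 0 else of_real (2 - 1 / real n)) * z ^ n"
        by (simp add: left_diff_distrib)
    qed
    finally show ?thesis by (simp add: extremal_function_def)
  qed
  hence "extremal_function has_fps_expansion Abs_fps (\<lambda>n. if n = 0 then 0 else of_real (2 - 1 / real n))"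
    using eventually_nhds_in_open[of unit_disc "0::complex"]
    by (intro has_fps_expansionI) (auto elim!: eventually_mono)
  moreover have "extremal_function has_fps_expansion fps_expansion extremal_function 0"
    using class_C1E[OF extremal_function_class_C1]
    by (metis has_fps_expansion_fps_expansion open_ball centre_in_ball zero_less_one)
  ultimately have "fps_expansion extremal_function 0 = Abs_fps (\<lambda>n. if n = 0 then 0 else of_real (2 - 1 / real n))"
    by (rule fps_expansion_unique_complex[rotated])
  thus ?thesis using assms by (simp add: taylor_coeff_def)
qed

section \<open>The Bohr radius\<close>

text \<open>The left side of the Bohr inequality at |z| = r when every coefficient has its extremal
  modulus 2 - 1/n.\<close>

definition bohr_majorant :: "real \<Rightarrow> real \<Rightarrow> real" where
  "bohr_majorant p r = r + (\<Sum>n. (2 - 1 / real (n + 2)) * r ^ (n + 2))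
     + (\<Sum>n. (2 - 1 / real (n + 2)) powr p * r powr (p * real (n + 2)))"

lemma extremal_coeff_ge_1: "2 - 1 / real (n + 2) \<ge> 1"
  by simp

text \<open>A geometric series combined with a logarithmic one; the last \<open>- r\<close> removes
  the term for n = 1.\<close>

lemma bohr_linear_sums:
  fixes r :: real
  assumes "0 \<le> r" "r < 1"
  shows "(\<lambda>n. (2 - 1 / real (n + 2)) * r ^ (n + 2)) sums (2 * r / (1 - r) + ln (1 - r) - r)"
proof -
  \<comment> \<open>The summand at index 0 is a division by zero, hence 0.\<close>
  have "(\<lambda>n. - (r ^ n) / real n) sums ln (1 - r)"
    using ln_series'[of "- r"] assms by simp
  hence "(\<lambda>n. - (r ^ (n + 2)) / real (n + 2)) sums (ln (1 - r) - (\<Sum>i<2. - (r ^ i) / real i))"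
    by (rule sums_split_initial_segment)
  moreover have "(\<lambda>n. 2 * r ^ 2 * r ^ n) sums (2 * r ^ 2 * (1 / (1 - r)))"
    using assms by (intro sums_mult geometric_sums) simp
  ultimately have "(\<lambda>n. 2 * r ^ 2 * r ^ n + - (r ^ (n + 2)) / real (n + 2)) sums
      (2 * r ^ 2 * (1 / (1 - r)) + (ln (1 - r) - (\<Sum>i<2. - (r ^ i) / real i)))"
    by (intro sums_add)
  also have "2 * r ^ 2 * (1 / (1 - r)) + (ln (1 - r) - (\<Sum>i<2. - (r ^ i) / real i)) = 2 * r / (1 - r) + ln (1 - r) - r"
    using assms by (simp add: numeral_2_eq_2) (simp add: field_simps)
  also have "(\<lambda>n. 2 * r ^ 2 * r ^ n + - (r ^ (n + 2)) / real (n + 2)) = (\<lambda>n. (2 - 1 / real (n + 2)) * r ^ (n + 2))"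
  proof
    fix n
    have "2 * r ^ 2 * r ^ n = 2 * r ^ (n + 2)" by (simp only: power_add mult_ac)
    thus "2 * r ^ 2 * r ^ n + - (r ^ (n + 2)) / real (n + 2) = (2 - 1 / real (n + 2)) * r ^ (n + 2)"
      by (simp only: left_diff_distrib) simp
  qed
  finally show ?thesis .
qed

lemma bohr_power_summable:
  fixes p r :: real
  assumes "p \<ge> 1" "0 \<le> r" "r < 1"
  shows "summable (\<lambda>n. (2 - 1 / real (n + 2)) powr p * r powr (p * real (n + 2)))"
  using summable_bohr_equation[of p r] assms by (cases "r = 0") auto

lemma bohr_majorant_closed_form:
  assumes "0 \<le> r" "r < 1"
  shows "bohr_majorant p r = 2 * r / (1 - r) + ln (1 - r)
     + (\<Sum>n. (2 - 1 / real (n + 2)) powr p * r powr (p * real (n + 2)))"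
  using bohr_linear_sums[OF assms] by (simp add: bohr_majorant_def sums_iff)

text \<open>After splitting ln (2 - 2 r), the left side of the equation is
  \<open>(1 - r) * (bohr_majorant p r - (1 - ln 2))\<close>.\<close>

lemma bohr_equation_iff:
  assumes "0 < r" "r < 1"
  shows "bohr_equation p r \<longleftrightarrow> bohr_majorant p r = 1 - ln 2"
proof -
  define P where "P = (\<Sum>n. (2 - 1 / real (n + 2)) powr p * r powr (p * real (n + 2)))"
  have l: "ln (2 - 2 * r) = ln 2 + ln (1 - r)"
    using ln_mult[of 2 "1 - r"] assms by (simp add: algebra_simps)
  have "(1 - r) * (bohr_majorant p r - (1 - ln 2)) =
      (1 - r) * P - (1 - 3 * r + r * ln 2 - ln (2 - 2 * r) + r * ln (1 - r))"
  proof -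
    have "(1 - r) * (2 * r / (1 - r)) = 2 * r" using assms by simp
    hence "(1 - r) * (2 * r / (1 - r) + ln (1 - r) + P - (1 - ln 2)) =
        2 * r + (1 - r) * (ln (1 - r) + P - (1 - ln 2))" by (simp only: distrib_left right_diff_distrib)
    moreover have "bohr_majorant p r = 2 * r / (1 - r) + ln (1 - r) + P"
      unfolding P_def using assms by (intro bohr_majorant_closed_form) auto
    ultimately show ?thesis unfolding l by (simp add: algebra_simps)
  qed
  thus ?thesis using assms unfolding bohr_equation_def P_def[symmetric] by (metis diff_eq_eq diff_self less_irrefl mult_eq_0_iff eq_iff_diff_eq_0)
qed

text \<open>The series are compared termwise; strictness comes from the isolated summand
  \<open>r\<close>.\<close>

lemma bohr_majorant_strict_mono:
  assumes p: "p \<ge> 1" and rs: "0 \<le> r" "r < s" "s < 1"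
  shows "bohr_majorant p r < bohr_majorant p s"
proof -
  have "(\<Sum>n. (2 - 1 / real (n + 2)) * r ^ (n + 2)) \<le> (\<Sum>n. (2 - 1 / real (n + 2)) * s ^ (n + 2))"
  proof (rule suminf_le)
    show "(2 - 1 / real (n + 2)) * r ^ (n + 2) \<le> (2 - 1 / real (n + 2)) * s ^ (n + 2)" for n
      using rs extremal_coeff_ge_1[of n] by (intro mult_left_mono power_mono) linarith+
    show "summable (\<lambda>n. (2 - 1 / real (n + 2)) * r ^ (n + 2))" "summable (\<lambda>n. (2 - 1 / real (n + 2)) * s ^ (n + 2))"
      using rs by (intro sums_summable[OF bohr_linear_sums]; simp)+
  qed
  moreover have "(\<Sum>n. (2 - 1 / real (n + 2)) powr p * r powr (p * real (n + 2)))
      \<le> (\<Sum>n. (2 - 1 / real (n + 2)) powr p * s powr (p * real (n + 2)))"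
    using p rs by (intro suminf_le mult_left_mono powr_mono2 bohr_power_summable) auto
  ultimately show ?thesis using rs by (simp add: bohr_majorant_def)
qed

text \<open>The power series part converges uniformly, being dominated by its terms at
  \<open>R\<close>; the rest has a closed form.\<close>

lemma bohr_majorant_continuous:
  assumes p: "p \<ge> 1" and R: "0 \<le> R" "R < 1"
  shows "continuous_on {0..R} (bohr_majorant p)"
proof -
  let ?t = "\<lambda>n r. (2 - 1 / real (n + 2)) powr p * r powr (p * real (n + 2))"
  have "uniform_limit {0..R} (\<lambda>N r. \<Sum>n<N. ?t n r) (\<lambda>r. \<Sum>n. ?t n r) sequentially"
  proof (rule Weierstrass_m_test)
    show "norm (?t n r) \<le> ?t n R" if "r \<in> {0..R}" for n r
    proof -
      have "r powr (p * real (n + 2)) \<le> R powr (p * real (n + 2))"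
        using that p by (intro powr_mono2) auto
      thus ?thesis by (simp add: abs_mult mult_left_mono)
    qed
    show "summable (\<lambda>n. ?t n R)" by (rule bohr_power_summable[OF p R])
  qed
  moreover have "continuous_on {0..R} (\<lambda>r. \<Sum>n<N. ?t n r)" for N
    using p by (intro continuous_intros continuous_on_powr') auto
  ultimately have "continuous_on {0..R} (\<lambda>r. \<Sum>n. ?t n r)"
    by (intro uniform_limit_theorem[where f = "\<lambda>N r. \<Sum>n<N. ?t n r" and F = sequentially]) auto
  hence "continuous_on {0..R} (\<lambda>r. 2 * r / (1 - r) + ln (1 - r) + (\<Sum>n. ?t n r))"
    using R by (intro continuous_intros) auto
  thus ?thesis
    using R by (subst continuous_on_cong[OF refl bohr_majorant_closed_form]) auto
qed

lemma bohr_radius_exists_unique: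
  assumes p: "p \<ge> 1"
  shows "\<exists>!r. 0 < r \<and> r < 1 \<and> bohr_equation p r"
proof -
  have "bohr_majorant p 0 = 0" by (simp add: bohr_majorant_def)
  \<comment> \<open>At 1/2 the closed form without the power series is already 2 - ln 2, so the root
    lies in [0, 1/2].\<close>
  moreover have "bohr_majorant p (1 / 2) \<ge> 1 - ln 2"
  proof -
    have "(\<Sum>n. (2 - 1 / real (n + 2)) powr p * (1 / 2) powr (p * real (n + 2))) \<ge> 0"
      using p by (intro suminf_nonneg bohr_power_summable) auto
    moreover have "ln (1 - 1 / 2) = - ln (2::real)" by (simp add: ln_div)
    ultimately show ?thesis by (simp add: bohr_majorant_closed_form)
  qed
  moreover have pos: "(0::real) < 1 - ln 2" using ln_2_less_1 by simp
  ultimately obtain r where r: "0 \<le> r" "r \<le> 1 / 2" "bohr_majorant p r = 1 - ln 2"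
    using IVT'[of "bohr_majorant p" 0 "1 - ln 2" "1 / 2"] bohr_majorant_continuous[OF p, of "1 / 2"] by auto
  have "r \<noteq> 0" using r(3) \<open>bohr_majorant p 0 = 0\<close> pos by auto
  show ?thesis
  proof (rule ex1I[of _ r])
    show "0 < r \<and> r < 1 \<and> bohr_equation p r" using r \<open>r \<noteq> 0\<close> by (simp add: bohr_equation_iff)
    fix s assume s: "0 < s \<and> s < 1 \<and> bohr_equation p s"
    hence "bohr_majorant p s = bohr_majorant p r" using r(3) bohr_equation_iff[of s p] by simp
    thus "s = r"
      using bohr_majorant_strict_mono[OF p, of s r] bohr_majorant_strict_mono[OF p, of r s] s r
      by (cases s r rule: linorder_cases) auto
  qed
qed

section \<open>The Bohr sum of a function in the class\<close>

lemma class_C1_bohr_term_le: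
  assumes "f \<in> class_C1"
  shows "bohr_term f z (n + 2) \<le> (2 - 1 / real (n + 2)) * cmod z ^ (n + 2)"
  unfolding bohr_term_def norm_mult norm_power
  by (intro mult_right_mono class_C1_coeff_bound[OF assms]) auto

lemma class_C1_bohr_power_term_le:
  assumes "f \<in> class_C1" "p \<ge> 1"
  shows "bohr_power_term p f z (n + 2) \<le> (2 - 1 / real (n + 2)) powr p * cmod z powr (p * real (n + 2))"
  unfolding bohr_power_term_def mult.commute[of p] using assms(2)
  by (intro mult_right_mono powr_mono2 class_C1_coeff_bound[OF assms(1)]) auto

lemma bohr_term_nonneg: "bohr_term f z n \<ge> 0" and bohr_power_term_nonneg: "bohr_power_term p f z n \<ge> 0"
  by (simp_all add: bohr_term_def bohr_power_term_def)

lemma class_C1_summable: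
  assumes f: "f \<in> class_C1" and p: "p \<ge> 1" and z: "z \<in> unit_disc"
  shows "summable (\<lambda>n. bohr_term f z (n + 2))" "summable (\<lambda>n. bohr_power_term p f z (n + 2))"
proof -
  show "summable (\<lambda>n. bohr_term f z (n + 2))"
    using z class_C1_bohr_term_le[OF f] bohr_term_nonneg
    by (intro summable_comparison_test'[OF sums_summable[OF bohr_linear_sums[of "cmod z"]]]) auto
  show "summable (\<lambda>n. bohr_power_term p f z (n + 2))"
    using z class_C1_bohr_power_term_le[OF f p] bohr_power_term_nonneg
    by (intro summable_comparison_test'[OF bohr_power_summable[OF p, of "cmod z"]]) auto
qed

lemma class_C1_bohr_sum_le:
  assumes f: "f \<in> class_C1" and p: "p \<ge> 1" and z: "z \<in> unit_disc"
  shows "cmod z + (\<Sum>n. bohr_term f z (n + 2)) + (\<Sum>n. bohr_power_term p f z (n + 2)) \<le> bohr_majorant p (cmod z)"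
  unfolding bohr_majorant_def using z
  by (intro add_mono order_refl suminf_le class_C1_bohr_term_le class_C1_bohr_power_term_le
      class_C1_summable bohr_power_summable sums_summable[OF bohr_linear_sums] f p) auto

theorem theorem2p4:
  fixes p :: real
  assumes "p \<ge> 1"
  shows "(\<forall>f\<in>class_C1. \<forall>z\<in>unit_disc.
            summable (\<lambda>n. bohr_term f z (n + 2)) \<and>
            summable (\<lambda>n. bohr_power_term p f z (n + 2))) \<and>
         (\<exists>!r. 0 < r \<and> r < 1 \<and> bohr_equation p r) \<and>
         (\<forall>r. 0 < r \<and> r < 1 \<and> bohr_equation p r \<longrightarrow>
            (\<forall>f\<in>class_C1. \<forall>z. cmod z \<le> r \<longrightarrow> bohr_inequality p f z) \<and>
            (\<forall>R>r. \<not> (\<forall>f\<in>class_C1. \<forall>z\<in>unit_disc. cmod z \<le> R \<longrightarrow> bohr_inequality p f z)))"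
proof (intro conjI allI impI ballI)
  show "\<exists>!r. 0 < r \<and> r < 1 \<and> bohr_equation p r" by (rule bohr_radius_exists_unique[OF assms])
next
  fix f z assume "f \<in> class_C1" "z \<in> unit_disc"
  thus "summable (\<lambda>n. bohr_term f z (n + 2))" "summable (\<lambda>n. bohr_power_term p f z (n + 2))"
    by (rule class_C1_summable[OF _ assms])+
next
  fix r f z assume r: "0 < r \<and> r < 1 \<and> bohr_equation p r" and f: "f \<in> class_C1" and z: "cmod z \<le> r"
  have "cmod z + (\<Sum>n. bohr_term f z (n + 2)) + (\<Sum>n. bohr_power_term p f z (n + 2)) \<le> bohr_majorant p (cmod z)"
    using r z by (intro class_C1_bohr_sum_le f assms) auto
  also have "\<dots> \<le> bohr_majorant p r"
    using bohr_majorant_strict_mono[OF assms, of "cmod z" r] r z by (cases "cmod z = r") auto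
  also have "\<dots> = 1 - ln 2" using r bohr_equation_iff by blast
  also have "\<dots> \<le> infdist (f 0) (frontier (f ` unit_disc))" by (rule class_C1_covering[OF f])
  finally show "bohr_inequality p f z" by (simp add: bohr_inequality_def)
next
  fix r R assume r: "0 < r \<and> r < 1 \<and> bohr_equation p r" and R: "r < R"
  \<comment> \<open>The minimum keeps \<open>s\<close> inside the unit disc even if \<open>R\<close>
    is 1 or more.\<close>
  define s where "s = (r + min R 1) / 2"
  have s: "r < s" "s < 1" "s \<le> R" "0 < s" using r R by (auto simp: s_def)
  have coeff: "cmod (taylor_coeff extremal_function (n + 2)) = 2 - 1 / real (n + 2)" for n
  proof -
    have "\<bar>2 - 1 / real (n + 2)\<bar> = 2 - 1 / real (n + 2)" using extremal_coeff_ge_1[of n] by linarith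
    moreover have "n + 2 > 0" by simp
    ultimately show ?thesis by (simp only: extremal_function_coeff norm_of_real)
  qed
  have s': "cmod (complex_of_real s) = s" using s by simp
  have "bohr_term extremal_function (of_real s) (n + 2) = (2 - 1 / real (n + 2)) * s ^ (n + 2)" for n
    by (simp only: bohr_term_def norm_mult norm_power coeff s')
  moreover have "bohr_power_term p extremal_function (of_real s) (n + 2) =
      (2 - 1 / real (n + 2)) powr p * s powr (p * real (n + 2))" for n
    by (simp only: bohr_power_term_def coeff s' mult.commute[of p])
  \<comment> \<open>For the extremal function each term equals its bound, so the sum at
    \<open>s\<close> is the majorant. It exceeds \<open>bohr_majorant p r\<close>, which is 1 - ln 2
    and hence at least the distance to the frontier.\<close>
  ultimately have "cmod (of_real s) + (\<Sum>n. bohr_term extremal_function (of_real s) (n + 2))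
      + (\<Sum>n. bohr_power_term p extremal_function (of_real s) (n + 2)) = bohr_majorant p s"
    by (simp only: bohr_majorant_def s')
  also have "\<dots> > bohr_majorant p r" using r s by (intro bohr_majorant_strict_mono assms) auto
  finally have "\<not> bohr_inequality p extremal_function (of_real s)"
    using extremal_function_covering bohr_equation_iff[of r p] r by (simp add: bohr_inequality_def)
  moreover have "complex_of_real s \<in> unit_disc" "cmod (of_real s) \<le> R" using s by auto
  ultimately show "\<not> (\<forall>f\<in>class_C1. \<forall>z\<in>unit_disc. cmod z \<le> R \<longrightarrow> bohr_inequality p f z)"
    using extremal_function_class_C1 by blast
qed

end
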